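(* If $M$ is a simple module in $\Omega^{\bar S_2}_{\mathbf 0}$, where $\mathbf 0=(0,0)$, then $M$ is isomorphic to the simple $\bar S_2$-submodule $T_1(A_2,V)$ of $T(A_2,V)$ generated by $V$, where $V$ is a finite-dimensional simple $\mathfrak{gl}_2$-module.
   Context: All vector spaces and algebras are over $\mathbb C$; $\otimes=\otimes_{\mathbb C}$. $A_2=\mathbb C[t_1,t_2]$, $\partial_i=\partial/\partial t_i$, $d_i=t_i\partial_i$, $e_1,e_2$ is the standard basis of $\mathbb C^2$, $t^\alpha=t_1^{\alpha_1}t_2^{\alpha_2}$. $\bar S_2$ is the Lie algebra of polynomial vector fields $p_1\partial_1+p_2\partial_2$ ($p_i\in A_2$) with $\partial_1(p_1)+\partial_2(p_2)\in\mathbb C$. For $\alpha\in\mathbb Z_{\ge -1}^2\setminus\{(-1,-1)\}$ put $L_\alpha=(1+\alpha_2)t^{\alpha+e_1}\partial_1-(1+\alpha_1)t^{\alpha+e_2}\partial_2$; these $L_\alpha$ together with $d_2$ span $\bar S_2$. $\Omega^{\bar S_2}_{\mathbf 0}$ is the category of $\bar S_2$-modules $M$ on which $\Delta_2=\mathrm{span}\{\partial_1,\partial_2\}$ acts locally finitely, such that for every $v\in M$ and $x\in\Delta_2$ one has $x^kv=0$ for some $k\in\mathbb N$, and such that $\mathrm{Wh}_{\mathbf 0}(M)=\{v\in M:\partial_1v=\partial_2v=0\}$ is finite-dimensional. For a $\mathfrak{gl}_2$-module $V$ (with matrix units $E_{ij}$), $T(A_2,V)=A_2\otimes V$ is the $\bar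 S_2$-module with action, for $p\in A_2$, $v\in V$, $$\begin{aligned} L_{\alpha}(p\otimes v)=\;&L_{\alpha}(p)\otimes v+(1+\alpha_1)(1+\alpha_2)t^{\alpha}p\otimes(E_{11}-E_{22})v\\&+\alpha_2(1+\alpha_2)t^{\alpha+e_1-e_2}p\otimes E_{21}v-\alpha_1(1+\alpha_1)t^{\alpha+e_2-e_1}p\otimes E_{12}v,\\ d_2(p\otimes v)=\;&d_2(p)\otimes v+p\otimes E_{22}v,\end{aligned}$$ where terms with zero coefficient are omitted. $V$ is identified with $1\otimes V\subset T(A_2,V)$. *)

theory Defs
  imports "HOL-Analysis.Analysis" "HOL-Library.Poly_Mapping"
begin

section \<open>Modules over a Lie algebra\<close>

text \<open>
  A Lie algebra is given by a carrier \<open>G\<close>, a scalar multiplication \<open>sG\<close> and a bracket \<open>br\<close>.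
  Its modules live on a subspace \<open>W\<close> of an ambient complex vector space with scalar
  multiplication \<open>sW\<close>; \<open>\<rho> x w\<close> is the action of \<open>x\<close> on \<open>w\<close> and matters only for
  \<open>x \<in> G\<close>, \<open>w \<in> W\<close>.
\<close>

definition lie_module ::
  "'g::ab_group_add set \<Rightarrow> (complex \<Rightarrow> 'g \<Rightarrow> 'g) \<Rightarrow> ('g \<Rightarrow> 'g \<Rightarrow> 'g) \<Rightarrow>
   (complex \<Rightarrow> 'w::ab_group_add \<Rightarrow> 'w) \<Rightarrow> 'w set \<Rightarrow> ('g \<Rightarrow> 'w \<Rightarrow> 'w) \<Rightarrow> bool"
where
  "lie_module G sG br sW W \<rho> \<longleftrightarrow>
     vector_space sW \<and> module.subspace sW W \<and>
     (\<forall>x\<in>G. \<forall>w\<in>W. \<rho> x w \<in> W) \<and>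
     (\<forall>x\<in>G. \<forall>v\<in>W. \<forall>w\<in>W. \<rho> x (v + w) = \<rho> x v + \<rho> x w) \<and>
     (\<forall>x\<in>G. \<forall>c. \<forall>w\<in>W. \<rho> x (sW c w) = sW c (\<rho> x w)) \<and>
     (\<forall>x\<in>G. \<forall>y\<in>G. \<forall>w\<in>W. \<rho> (x + y) w = \<rho> x w + \<rho> y w) \<and>
     (\<forall>c. \<forall>x\<in>G. \<forall>w\<in>W. \<rho> (sG c x) w = sW c (\<rho> x w)) \<and>
     (\<forall>x\<in>G. \<forall>y\<in>G. \<forall>w\<in>W. \<rho> (br x y) w = \<rho> x (\<rho> y w) - \<rho> y (\<rho> x w))"

definition lie_submodule ::
  "'g set \<Rightarrow> (complex \<Rightarrow> 'w::ab_group_add \<Rightarrow> 'w) \<Rightarrow> 'w set \<Rightarrow> ('g \<Rightarrow> 'w \<Rightarrow> 'w) \<Rightarrow> 'w set \<Rightarrow> bool"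
where
  "lie_submodule G sW W \<rho> U \<longleftrightarrow>
     module.subspace sW U \<and> U \<subseteq> W \<and> (\<forall>x\<in>G. \<forall>u\<in>U. \<rho> x u \<in> U)"

definition simple_lie_module ::
  "'g set \<Rightarrow> (complex \<Rightarrow> 'w::ab_group_add \<Rightarrow> 'w) \<Rightarrow> 'w set \<Rightarrow> ('g \<Rightarrow> 'w \<Rightarrow> 'w) \<Rightarrow> bool"
where
  "simple_lie_module G sW W \<rho> \<longleftrightarrow>
     W \<noteq> {0} \<and> (\<forall>U. lie_submodule G sW W \<rho> U \<longrightarrow> U = {0} \<or> U = W)"

definition generated_submodule ::
  "'g set \<Rightarrow> (complex \<Rightarrow> 'w::ab_group_add \<Rightarrow> 'w) \<Rightarrow> 'w set \<Rightarrow> ('g \<Rightarrow> 'w \<Rightarrow> 'w) \<Rightarrow> 'w set \<Rightarrow> 'w set"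
where
  "generated_submodule G sW W \<rho> S = \<Inter>{U. lie_submodule G sW W \<rho> U \<and> S \<subseteq> U}"

definition lie_module_iso ::
  "'g set \<Rightarrow> (complex \<Rightarrow> 'w::ab_group_add \<Rightarrow> 'w) \<Rightarrow> 'w set \<Rightarrow> ('g \<Rightarrow> 'w \<Rightarrow> 'w) \<Rightarrow>
   (complex \<Rightarrow> 'u::ab_group_add \<Rightarrow> 'u) \<Rightarrow> 'u set \<Rightarrow> ('g \<Rightarrow> 'u \<Rightarrow> 'u) \<Rightarrow> bool"
where
  "lie_module_iso G sW W \<rho> sU U \<sigma> \<longleftrightarrow>
     (\<exists>\<phi>. bij_betw \<phi> W U \<and>
          (\<forall>v\<in>W. \<forall>w\<in>W. \<phi> (v + w) = \<phi> v + \<phi> w) \<and>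
          (\<forall>c. \<forall>w\<in>W. \<phi> (sW c w) = sU c (\<phi> w)) \<and>
          (\<forall>x\<in>G. \<forall>w\<in>W. \<phi> (\<rho> x w) = \<sigma> x (\<phi> w)))"

definition finite_dim :: "(complex \<Rightarrow> 'w::ab_group_add \<Rightarrow> 'w) \<Rightarrow> 'w set \<Rightarrow> bool" where
  "finite_dim sW U \<longleftrightarrow> (\<exists>B. finite B \<and> module.span sW B = U)"


section \<open>Polynomial vector fields in two variables\<close>

text \<open>The exponent \<open>(a, b)\<close> stands for the monomial \<open>t\<^sub>1\<^sup>a t\<^sub>2\<^sup>b\<close>.\<close>

type_synonym poly2 = "(nat \<times> nat) \<Rightarrow>\<^sub>0 complex"

lift_definition pd1 :: "poly2 \<Rightarrow> poly2" is
  "\<lambda>p (a, b). of_nat (Suc a) * p (Suc a, b)"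
proof -
  fix p :: "nat \<times> nat \<Rightarrow> complex"
  assume "finite {k. p k \<noteq> 0}"
  then have "finite ((\<lambda>(a, b). (a - 1, b)) ` {k. p k \<noteq> 0})" by simp
  moreover have "{k. (case k of (a, b) \<Rightarrow> of_nat (Suc a) * p (Suc a, b)) \<noteq> 0}
      \<subseteq> (\<lambda>(a, b). (a - 1, b)) ` {k. p k \<noteq> 0}"
    by (force simp: image_iff simp del: of_nat_Suc)
  ultimately show "finite {k. (case k of (a, b) \<Rightarrow> of_nat (Suc a) * p (Suc a, b)) \<noteq> 0}"
    by (rule rev_finite_subset)
qed

lift_definition pd2 :: "poly2 \<Rightarrow> poly2" is
  "\<lambda>p (a, b). of_nat (Suc b) * p (a, Suc b)"
proof -
  fix p :: "nat \<times> nat \<Rightarrow> complex"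
  assume "finite {k. p k \<noteq> 0}"
  then have "finite ((\<lambda>(a, b). (a, b - 1)) ` {k. p k \<noteq> 0})" by simp
  moreover have "{k. (case k of (a, b) \<Rightarrow> of_nat (Suc b) * p (a, Suc b)) \<noteq> 0}
      \<subseteq> (\<lambda>(a, b). (a, b - 1)) ` {k. p k \<noteq> 0}"
    by (force simp: image_iff simp del: of_nat_Suc)
  ultimately show "finite {k. (case k of (a, b) \<Rightarrow> of_nat (Suc b) * p (a, Suc b)) \<noteq> 0}"
    by (rule rev_finite_subset)
qed

text \<open>The pair \<open>(p\<^sub>1, p\<^sub>2)\<close> stands for the vector field \<open>p\<^sub>1\<partial>\<^sub>1 + p\<^sub>2\<partial>\<^sub>2\<close>.\<close>

type_synonym vfield = "poly2 \<times> poly2"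

definition vf_app :: "vfield \<Rightarrow> poly2 \<Rightarrow> poly2" where
  "vf_app X f = fst X * pd1 f + snd X * pd2 f"

definition vf_scale :: "complex \<Rightarrow> vfield \<Rightarrow> vfield" where
  "vf_scale c X = (Poly_Mapping.single 0 c * fst X, Poly_Mapping.single 0 c * snd X)"

definition vf_bracket :: "vfield \<Rightarrow> vfield \<Rightarrow> vfield" where
  "vf_bracket X Y =
     (vf_app X (fst Y) - vf_app Y (fst X), vf_app X (snd Y) - vf_app Y (snd X))"

definition S2bar :: "vfield set" where
  "S2bar = {X. \<exists>c. pd1 (fst X) + pd2 (snd X) = Poly_Mapping.single 0 c}"

definition vf_d1 :: vfield where "vf_d1 = (1, 0)"   \<comment> \<open>\<open>\<partial>\<^sub>1\<close>\<close>
definition vf_d2 :: vfield where "vf_d2 = (0, 1)"   \<comment> \<open>\<open>\<partial>\<^sub>2\<close>\<close>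

definition Delta2 :: "vfield set" where
  "Delta2 = module.span vf_scale {vf_d1, vf_d2}"

text \<open>
  Monomials with integer exponents; a negative exponent only ever occurs below together
  with the coefficient zero.
\<close>

definition tmon :: "int \<Rightarrow> int \<Rightarrow> poly2" where
  "tmon a b = Poly_Mapping.single (nat a, nat b) 1"

definition vf_L :: "int \<Rightarrow> int \<Rightarrow> vfield" where
  "vf_L a b = (Poly_Mapping.single 0 (of_int (1 + b)) * tmon (a + 1) b,
               - (Poly_Mapping.single 0 (of_int (1 + a)) * tmon a (b + 1)))"

definition vf_t2d2 :: vfield where "vf_t2d2 = (0, tmon 0 1)"   \<comment> \<open>\<open>d\<^sub>2 = t\<^sub>2\<partial>\<^sub>2\<close>\<close>


section \<open>The category \<open>\<Omega>\<^sub>0\<close>\<close>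

definition Wh0 :: "'m::ab_group_add set \<Rightarrow> (vfield \<Rightarrow> 'm \<Rightarrow> 'm) \<Rightarrow> 'm set" where
  "Wh0 M \<rho> = {v\<in>M. \<rho> vf_d1 v = 0 \<and> \<rho> vf_d2 v = 0}"

definition Omega0 ::
  "(complex \<Rightarrow> 'm::ab_group_add \<Rightarrow> 'm) \<Rightarrow> 'm set \<Rightarrow> (vfield \<Rightarrow> 'm \<Rightarrow> 'm) \<Rightarrow> bool"
where
  "Omega0 sc M \<rho> \<longleftrightarrow>
     lie_module S2bar vf_scale vf_bracket sc M \<rho> \<and>
     (\<forall>v\<in>M. \<exists>U. lie_submodule Delta2 sc M \<rho> U \<and> finite_dim sc U \<and> v \<in> U) \<and>
     (\<forall>v\<in>M. \<forall>x\<in>Delta2. \<exists>k::nat. (\<rho> x ^^ k) v = 0) \<and>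
     finite_dim sc (Wh0 M \<rho>)"


section \<open>\<open>gl\<^sub>2\<close>-modules and the tensor modules \<open>T(A\<^sub>2, V)\<close>\<close>

definition gl2_scale :: "complex \<Rightarrow> complex^2^2 \<Rightarrow> complex^2^2" where
  "gl2_scale c A = (\<chi> i j. c * A $ i $ j)"

definition gl2_bracket :: "complex^2^2 \<Rightarrow> complex^2^2 \<Rightarrow> complex^2^2" where
  "gl2_bracket A B = A ** B - B ** A"

definition gl2_E :: "2 \<Rightarrow> 2 \<Rightarrow> complex^2^2" where
  "gl2_E i j = (\<chi> k l. if k = i \<and> l = j then 1 else 0)"

definition gl2_module ::
  "(complex \<Rightarrow> 'v::ab_group_add \<Rightarrow> 'v) \<Rightarrow> 'v set \<Rightarrow> (complex^2^2 \<Rightarrow> 'v \<Rightarrow> 'v) \<Rightarrow> bool"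
where
  "gl2_module sc V \<pi> \<longleftrightarrow> lie_module UNIV gl2_scale gl2_bracket sc V \<pi>"

text \<open>
  \<open>A\<^sub>2 \<otimes> V\<close> is realised as the space of polynomials with coefficients in \<open>V\<close>, the pure
  tensor \<open>p \<otimes> v\<close> having the coefficients \<open>p\<^sub>\<alpha> v\<close>.
\<close>

definition tensor_scale ::
  "(complex \<Rightarrow> 'v::ab_group_add \<Rightarrow> 'v) \<Rightarrow> complex \<Rightarrow> ((nat \<times> nat) \<Rightarrow>\<^sub>0 'v) \<Rightarrow> ((nat \<times> nat) \<Rightarrow>\<^sub>0 'v)"
where
  "tensor_scale sc c f = Poly_Mapping.map (sc c) f"

definition tens ::
  "(complex \<Rightarrow> 'v::ab_group_add \<Rightarrow> 'v) \<Rightarrow> poly2 \<Rightarrow> 'v \<Rightarrow> ((nat \<times> nat) \<Rightarrow>\<^sub>0 'v)"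
where
  "tens sc p v = Poly_Mapping.map (\<lambda>c. sc c v) p"

definition T_carrier :: "'v::ab_group_add set \<Rightarrow> ((nat \<times> nat) \<Rightarrow>\<^sub>0 'v) set" where
  "T_carrier V = {f. \<forall>k. Poly_Mapping.lookup f k \<in> V}"

text \<open>
  By linearity it suffices to prescribe the action on \<open>t\<^sup>k \<otimes> v\<close>.  The action of \<open>X = p\<^sub>1\<partial>\<^sub>1 + p\<^sub>2\<partial>\<^sub>2\<close> on \<open>p \<otimes> v\<close> is
  \<open>X(p) \<otimes> v + \<Sum>\<^sub>i\<^sub>j \<partial>\<^sub>i(p\<^sub>j) p \<otimes> E\<^sub>i\<^sub>j v\<close>.  For \<open>X = L\<^sub>\<alpha>\<close> and
  \<open>X = d\<^sub>2\<close>, which span \<open>S2bar\<close>, this gives the usual defining formulas; see \<open>T_act_L\<close>,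
  \<open>T_act_t2d2\<close>, \<open>T_act_add\<close>, \<open>T_act_scale\<close> and \<open>S2bar_eq_span\<close> below.
\<close>

definition T_pure ::
  "(complex \<Rightarrow> 'v::ab_group_add \<Rightarrow> 'v) \<Rightarrow> (complex^2^2 \<Rightarrow> 'v \<Rightarrow> 'v) \<Rightarrow>
   vfield \<Rightarrow> poly2 \<Rightarrow> 'v \<Rightarrow> ((nat \<times> nat) \<Rightarrow>\<^sub>0 'v)"
where
  "T_pure sc \<pi> X p v =
     tens sc (vf_app X p) v
     + tens sc (pd1 (fst X) * p) (\<pi> (gl2_E 1 1) v)
     + tens sc (pd1 (snd X) * p) (\<pi> (gl2_E 1 2) v)
     + tens sc (pd2 (fst X) * p) (\<pi> (gl2_E 2 1) v)
     + tens sc (pd2 (snd X) * p) (\<pi> (gl2_E 2 2) v)"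

definition T_act ::
  "(complex \<Rightarrow> 'v::ab_group_add \<Rightarrow> 'v) \<Rightarrow> (complex^2^2 \<Rightarrow> 'v \<Rightarrow> 'v) \<Rightarrow>
   vfield \<Rightarrow> ((nat \<times> nat) \<Rightarrow>\<^sub>0 'v) \<Rightarrow> ((nat \<times> nat) \<Rightarrow>\<^sub>0 'v)"
where
  "T_act sc \<pi> X f =
     (\<Sum>k\<in>Poly_Mapping.keys f.
        T_pure sc \<pi> X (Poly_Mapping.single k 1) (Poly_Mapping.lookup f k))"

definition T1 ::
  "(complex \<Rightarrow> 'v::ab_group_add \<Rightarrow> 'v) \<Rightarrow> 'v set \<Rightarrow> (complex^2^2 \<Rightarrow> 'v \<Rightarrow> 'v) \<Rightarrow>
   ((nat \<times> nat) \<Rightarrow>\<^sub>0 'v) set"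
where
  "T1 sc V \<pi> =
     generated_submodule S2bar (tensor_scale sc) (T_carrier V) (T_act sc \<pi>) (tens sc 1 ` V)"


subsection \<open>Agreement with the defining formulas\<close>

lemma lookup_pd1: "Poly_Mapping.lookup (pd1 p) (a, b) = of_nat (Suc a) * Poly_Mapping.lookup p (Suc a, b)"
  by (simp add: pd1.rep_eq)

lemma lookup_pd2: "Poly_Mapping.lookup (pd2 p) (a, b) = of_nat (Suc b) * Poly_Mapping.lookup p (a, Suc b)"
  by (simp add: pd2.rep_eq)

lemma lookup_const_times:
  "Poly_Mapping.lookup (Poly_Mapping.single 0 c * (p :: poly2)) k = c * Poly_Mapping.lookup p k"
  unfolding mult_map_scale_conv_mult[symmetric]
  by (simp add: Poly_Mapping.map.rep_eq when_def)

lemma pd_add: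
  "pd1 (p + q) = pd1 p + pd1 q" "pd2 (p + q) = pd2 p + pd2 q"
  by (auto intro!: poly_mapping_eqI simp: lookup_pd1 lookup_pd2 lookup_add algebra_simps)

lemma pd_const_times:
  "pd1 (Poly_Mapping.single 0 c * p) = Poly_Mapping.single 0 c * pd1 p"
  "pd2 (Poly_Mapping.single 0 c * p) = Poly_Mapping.single 0 c * pd2 p"
  by (auto intro!: poly_mapping_eqI simp: lookup_pd1 lookup_pd2 lookup_const_times)

lemma pd_zero: "pd1 0 = 0" "pd2 0 = 0"
  by (auto intro!: poly_mapping_eqI simp: lookup_pd1 lookup_pd2)

lemma pd_uminus: "pd1 (- p) = - pd1 p" "pd2 (- p) = - pd2 p"
  by (auto intro!: poly_mapping_eqI simp: lookup_pd1 lookup_pd2)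

lemma pd_monomial:
  "pd1 (Poly_Mapping.single (a, b) c) = Poly_Mapping.single (a - 1, b) (of_nat a * c)"
  "pd2 (Poly_Mapping.single (a, b) c) = Poly_Mapping.single (a, b - 1) (of_nat b * c)"
  by (rule poly_mapping_eqI; cases a; cases b;
      force simp: lookup_pd1 lookup_pd2 lookup_single when_def simp del: of_nat_Suc)+

lemma pd_vf_L:
  assumes a: "a \<ge> -1" and b: "b \<ge> -1"
  defines "s \<equiv> \<lambda>n i j. Poly_Mapping.single 0 (of_int n :: complex) * tmon i j"
  shows "pd1 (fst (vf_L a b)) = s ((1 + a) * (1 + b)) a b"
    and "pd2 (fst (vf_L a b)) = s (b * (1 + b)) (a + 1) (b - 1)"
    and "pd1 (snd (vf_L a b)) = - s (a * (1 + a)) (a - 1) (b + 1)"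
    and "pd2 (snd (vf_L a b)) = - s ((1 + a) * (1 + b)) a b"
proof -
  have n: "nat (x + 1) - Suc 0 = nat x" "nat x - Suc 0 = nat (x - 1)" for x :: int
    by auto
  have s: "s m i j = Poly_Mapping.single (nat i, nat j) (of_int m)" for m i j
    by (simp add: s_def tmon_def mult_single del: single_of_int)
  have L: "vf_L a b = (Poly_Mapping.single (nat (a + 1), nat b) (of_int (1 + b)),
      - Poly_Mapping.single (nat a, nat (b + 1)) (of_int (1 + a)))"
    by (simp add: vf_L_def tmon_def mult_single del: single_of_int of_int_add)
  have coeff: "(of_nat (nat (x + 1)) :: complex) = of_int (x + 1)" if "x \<ge> -1" for x
    using that of_nat_nat[of "x + 1"] by simp
  have coeff': "of_nat (nat x) * (of_int (1 + x) :: complex) = of_int (x * (1 + x))" if "x \<ge> -1" for x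
  proof (cases "x = -1")
    case False
    then have "x \<ge> 0" using that by simp
    then show ?thesis using of_nat_nat[of x] by simp
  qed simp
  show "pd1 (fst (vf_L a b)) = s ((1 + a) * (1 + b)) a b"
    by (simp add: s L pd_monomial n coeff[OF a] del: of_int_add)
      (simp add: add.commute)
  show "pd2 (fst (vf_L a b)) = s (b * (1 + b)) (a + 1) (b - 1)"
    by (simp add: s L pd_monomial n coeff'[OF b] del: of_int_add of_int_mult)
  show "pd1 (snd (vf_L a b)) = - s (a * (1 + a)) (a - 1) (b + 1)"
    by (simp add: s L pd_uminus pd_monomial n coeff'[OF a] del: of_int_add of_int_mult)
  show "pd2 (snd (vf_L a b)) = - s ((1 + a) * (1 + b)) a b"
    by (simp add: s L pd_uminus pd_monomial n coeff[OF b] del: of_int_add)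
      (simp add: add.commute mult.commute)
qed

lemma vector_space_vf_scale: "vector_space vf_scale"
  by unfold_locales
    (auto simp: vf_scale_def algebra_simps single_add mult_single mult.assoc[symmetric] prod_eq_iff)

lemma poly2_eq_sum_monomials:
  "(p :: poly2) = (\<Sum>k\<in>Poly_Mapping.keys p. Poly_Mapping.single k (Poly_Mapping.lookup p k))"
proof (rule poly_mapping_eqI)
  fix k
  have "Poly_Mapping.lookup (\<Sum>k\<in>Poly_Mapping.keys p. Poly_Mapping.single k (Poly_Mapping.lookup p k)) k
      = (\<Sum>j\<in>Poly_Mapping.keys p. if j = k then Poly_Mapping.lookup p j else 0)"
    by (simp add: lookup_sum lookup_single when_def)
  also have "\<dots> = Poly_Mapping.lookup p k"
    by (simp add: in_keys_iff)
  finally show "Poly_Mapping.lookup p k = Poly_Mapping.lookup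
      (\<Sum>k\<in>Poly_Mapping.keys p. Poly_Mapping.single k (Poly_Mapping.lookup p k)) k" ..
qed

context
  fixes sc :: "complex \<Rightarrow> 'v::ab_group_add \<Rightarrow> 'v"
  assumes vs: "vector_space sc"
begin

interpretation V: vector_space sc by (rule vs)

lemma lookup_tens: "Poly_Mapping.lookup (tens sc p v) k = sc (Poly_Mapping.lookup p k) v"
  by (simp add: tens_def Poly_Mapping.map.rep_eq when_def)

lemma lookup_tensor_scale:
  "Poly_Mapping.lookup (tensor_scale sc c f) k = sc c (Poly_Mapping.lookup f k)"
  by (simp add: tensor_scale_def Poly_Mapping.map.rep_eq when_def)

lemma vector_space_tensor_scale: "vector_space (tensor_scale sc)"
  by unfold_locales
    (auto intro!: poly_mapping_eqI
      simp: lookup_tensor_scale lookup_add V.scale_right_distrib V.scale_left_distrib)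

lemma tens_add_left: "tens sc (p + q) v = tens sc p v + tens sc q v"
  by (rule poly_mapping_eqI) (simp add: lookup_tens lookup_add V.scale_left_distrib)

lemma tens_zero_left: "tens sc 0 v = 0"
  by (rule poly_mapping_eqI) (simp add: lookup_tens)

lemma tens_add_right: "tens sc p (v + w) = tens sc p v + tens sc p w"
  by (rule poly_mapping_eqI) (simp add: lookup_tens lookup_add V.scale_right_distrib)

lemma tens_scale_left:
  "tens sc (Poly_Mapping.single 0 c * p) v = tensor_scale sc c (tens sc p v)"
  by (rule poly_mapping_eqI) (simp add: lookup_tens lookup_tensor_scale lookup_const_times)

lemma tens_scale_right: "tens sc p (sc c v) = tens sc (Poly_Mapping.single 0 c * p) v"
  by (rule poly_mapping_eqI) (simp add: lookup_tens lookup_const_times mult.commute[of _ c])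

lemma tens_zero_right: "tens sc p 0 = 0"
  by (rule poly_mapping_eqI) (simp add: lookup_tens)

lemma T_pure_add_poly: "T_pure sc \<pi> X (p + q) v = T_pure sc \<pi> X p v + T_pure sc \<pi> X q v"
  by (simp add: T_pure_def vf_app_def pd_add distrib_left tens_add_left algebra_simps)

lemma T_pure_zero_poly: "T_pure sc \<pi> X 0 v = 0"
  by (simp add: T_pure_def vf_app_def pd_zero tens_zero_left)

lemma T_pure_sum_poly: "T_pure sc \<pi> X (\<Sum>k\<in>K. p k) v = (\<Sum>k\<in>K. T_pure sc \<pi> X (p k) v)"
  by (induction K rule: infinite_finite_induct) (simp_all add: T_pure_add_poly T_pure_zero_poly)

lemma T_act_add: "T_act sc \<pi> (X + Y) f = T_act sc \<pi> X f + T_act sc \<pi> Y f"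
  by (simp add: T_act_def T_pure_def vf_app_def pd_add distrib_right tens_add_left
      flip: sum.distrib) (simp add: algebra_simps)

lemma T_act_scale: "T_act sc \<pi> (vf_scale c X) f = tensor_scale sc c (T_act sc \<pi> X f)"
proof -
  interpret T: vector_space "tensor_scale sc" by (rule vector_space_tensor_scale)
  show ?thesis
    by (simp add: T_act_def T_pure_def vf_app_def vf_scale_def pd_const_times mult.assoc
        T.scale_sum_right T.scale_right_distrib flip: tens_scale_left distrib_left)
qed

lemma T_act_tens:
  assumes \<pi>: "gl2_module sc V \<pi>" and v: "v \<in> V"
  shows "T_act sc \<pi> X (tens sc p v) = T_pure sc \<pi> X p v"
proof (cases "v = 0")
  case True
  have "\<pi> A 0 = 0" for A
  proof -
    have "\<pi> A (sc 0 v) = sc 0 (\<pi> A v)"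
      using \<pi> v unfolding gl2_module_def lie_module_def by blast
    then show ?thesis by simp
  qed
  then show ?thesis using True by (simp add: T_act_def T_pure_def tens_zero_right)
next
  case False
  then have keys: "Poly_Mapping.keys (tens sc p v) = Poly_Mapping.keys p"
    by (auto simp: in_keys_iff lookup_tens)
  have \<pi>_scale: "\<pi> A (sc c v) = sc c (\<pi> A v)" for A c
    using \<pi> v unfolding gl2_module_def lie_module_def by blast
  have "T_pure sc \<pi> X (Poly_Mapping.single k 1) (sc c v)
      = T_pure sc \<pi> X (Poly_Mapping.single k c) v" for k c
  proof -
    have single: "Poly_Mapping.single k c
        = Poly_Mapping.single 0 c * (Poly_Mapping.single k 1 :: poly2)"
      by (simp add: mult_single)
    show ?thesis
      unfolding single T_pure_def
      by (simp add: \<pi>_scale tens_scale_right vf_app_def pd_const_times distrib_left mult.left_commute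
          del: single_one)
  qed
  then have "T_act sc \<pi> X (tens sc p v)
      = (\<Sum>k\<in>Poly_Mapping.keys p. T_pure sc \<pi> X (Poly_Mapping.single k (Poly_Mapping.lookup p k)) v)"
    by (simp add: T_act_def keys lookup_tens)
  also have "\<dots> = T_pure sc \<pi> X p v"
    by (simp add: poly2_eq_sum_monomials[symmetric] flip: T_pure_sum_poly)
  finally show ?thesis .
qed

lemma T_act_t2d2:
  assumes "gl2_module sc V \<pi>" "v \<in> V"
  shows "T_act sc \<pi> vf_t2d2 (tens sc p v)
       = tens sc (vf_app vf_t2d2 p) v + tens sc p (\<pi> (gl2_E 2 2) v)"
proof -
  have "Poly_Mapping.single (0, 0) (1::complex) = 1"
    by (simp flip: zero_prod_def)
  then have "pd2 (snd vf_t2d2) = 1" "pd1 (snd vf_t2d2) = 0"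
    "pd1 (fst vf_t2d2) = 0" "pd2 (fst vf_t2d2) = 0"
    by (simp_all add: vf_t2d2_def tmon_def pd_monomial pd_zero)
  then show ?thesis
    by (simp add: T_act_tens[OF assms] T_pure_def tens_zero_left)
qed

lemma T_act_L:
  assumes \<pi>: "gl2_module sc V \<pi>" and v: "v \<in> V" and a: "a \<ge> -1" and b: "b \<ge> -1"
  shows "T_act sc \<pi> (vf_L a b) (tens sc p v)
       = tens sc (vf_app (vf_L a b) p) v
         + tens sc (Poly_Mapping.single 0 (of_int ((1 + a) * (1 + b))) * tmon a b * p)
             (\<pi> (gl2_E 1 1 - gl2_E 2 2) v)
         + tens sc (Poly_Mapping.single 0 (of_int (b * (1 + b))) * tmon (a + 1) (b - 1) * p)
             (\<pi> (gl2_E 2 1) v)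
         - tens sc (Poly_Mapping.single 0 (of_int (a * (1 + a))) * tmon (a - 1) (b + 1) * p)
             (\<pi> (gl2_E 1 2) v)"
proof -
  note pdL = pd_vf_L[OF a b]
  have neg: "tens sc (- q) w = - tens sc q w" for q w
    by (rule poly_mapping_eqI) (simp add: lookup_tens)
  have diff: "\<pi> (gl2_E 1 1 - gl2_E 2 2) v = \<pi> (gl2_E 1 1) v - \<pi> (gl2_E 2 2) v"
  proof -
    have "\<pi> (gl2_E 1 1 - gl2_E 2 2 + gl2_E 2 2) v
        = \<pi> (gl2_E 1 1 - gl2_E 2 2) v + \<pi> (gl2_E 2 2) v"
      using \<pi> v unfolding gl2_module_def lie_module_def by blast
    then show ?thesis by simp
  qed
  have tdiff: "tens sc q (x - y) = tens sc q x - tens sc q y" for q x y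
    by (rule poly_mapping_eqI) (simp add: lookup_tens lookup_minus V.scale_right_diff_distrib)
  show ?thesis
    unfolding T_act_tens[OF \<pi> v] T_pure_def pdL diff tdiff
    by (simp only: minus_mult_left[symmetric] neg) (simp add: algebra_simps)
qed

end

lemma S2bar_eq_span:
  "S2bar = module.span vf_scale
     (insert vf_t2d2 {vf_L a b | a b. a \<ge> -1 \<and> b \<ge> -1 \<and> (a, b) \<noteq> (-1, -1)})"
  (is "_ = module.span vf_scale ?S")
proof
  interpret F: vector_space vf_scale by (rule vector_space_vf_scale)
  define dv where "dv X = pd1 (fst X) + pd2 (snd X)" for X :: vfield
  have dv_add: "dv (X + Y) = dv X + dv Y" for X Y
    by (simp add: dv_def pd_add algebra_simps)
  have dv_scale: "dv (vf_scale c X) = Poly_Mapping.single 0 c * dv X" for c X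
    by (simp add: dv_def vf_scale_def pd_const_times distrib_left)
  have dv_0: "dv 0 = 0"
    by (simp add: dv_def pd_zero)
  have dv_sum: "dv (\<Sum>k\<in>K. f k) = (\<Sum>k\<in>K. dv (f k))" for f and K :: "(nat \<times> nat) set"
    by (induction K rule: infinite_finite_induct) (simp_all add: dv_add dv_0)
  have dv_diff: "dv (X - Y) = dv X - dv Y" for X Y
    using dv_add[of "X - Y" Y] by simp
  have dv_L: "dv (vf_L a b) = 0" if "a \<ge> -1" "b \<ge> -1" for a b
    by (simp add: dv_def pd_vf_L[OF that])
  have dv_t2d2: "dv vf_t2d2 = 1"
    by (simp add: dv_def vf_t2d2_def tmon_def pd_monomial pd_zero flip: zero_prod_def)
  have S2: "S2bar = {X. \<exists>c. dv X = Poly_Mapping.single 0 c}"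
    by (simp add: S2bar_def dv_def)
  have in_S: "vf_L a b \<in> F.span ?S" if "a \<ge> -1" "b \<ge> -1" "(a, b) \<noteq> (-1, -1)" for a b
    using that by (intro F.span_base) blast
  show "module.span vf_scale ?S \<subseteq> S2bar"
  proof (rule F.span_minimal)
    show "?S \<subseteq> S2bar"
      by (auto simp: S2 dv_L dv_t2d2 intro: exI[of _ 0] exI[of _ 1])
    show "F.subspace S2bar"
    proof (rule F.subspaceI)
      show "0 \<in> S2bar" by (auto simp: S2 dv_0 intro: exI[of _ 0])
      show "X + Y \<in> S2bar" if "X \<in> S2bar" "Y \<in> S2bar" for X Y
        using that by (auto simp: S2 dv_add simp flip: single_add)
      show "vf_scale c X \<in> S2bar" if "X \<in> S2bar" for c X
        using that by (auto simp: S2 dv_scale mult_single)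
    qed
  qed
  show "S2bar \<subseteq> module.span vf_scale ?S"
  proof
    fix X assume "X \<in> S2bar"
    then obtain c where c: "dv X = Poly_Mapping.single 0 c" by (auto simp: S2)
    define p where "p = fst X"
    define Y1 where "Y1 = vf_scale c vf_t2d2"
    define Y2 where "Y2 = (\<Sum>k\<in>Poly_Mapping.keys p.
      vf_scale (Poly_Mapping.lookup p k / of_nat (Suc (snd k))) (vf_L (int (fst k) - 1) (int (snd k))))"
    define Z where "Z = X - Y1 - Y2"
    define r where "r = snd Z"
    have fst_sum: "fst (\<Sum>k\<in>K. f k) = (\<Sum>k\<in>K. fst (f k))"
      for f :: "nat \<times> nat \<Rightarrow> vfield" and K
      by (induction K rule: infinite_finite_induct) simp_all
    have snd_sum: "snd (\<Sum>k\<in>K. f k) = (\<Sum>k\<in>K. snd (f k))"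
      for f :: "nat \<times> nat \<Rightarrow> vfield" and K
      by (induction K rule: infinite_finite_induct) simp_all
    have "fst (vf_scale (x / of_nat (Suc (snd k))) (vf_L (int (fst k) - 1) (int (snd k))))
        = Poly_Mapping.single k x" for k x
    proof -
      have "x / of_nat (Suc (snd k)) * (1 + of_nat (snd k)) = x"
        using of_nat_neq_0[of "snd k", where ?'a = complex] by (simp add: add.commute)
      then show ?thesis
        by (simp add: vf_scale_def vf_L_def tmon_def mult_single)
    qed
    then have "fst Y2 = p"
      by (simp add: Y2_def fst_sum poly2_eq_sum_monomials[symmetric] del: of_nat_Suc)
    then have Z: "Z = (0, r)"
      by (simp add: Z_def r_def p_def Y1_def vf_scale_def vf_t2d2_def prod_eq_iff)
    have "dv Y2 = 0"
      by (simp add: Y2_def dv_sum dv_scale dv_L)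
    then have "dv Z = 0"
      by (simp add: Z_def dv_diff c Y1_def dv_scale dv_t2d2)
    then have "pd2 r = 0"
      by (simp add: Z dv_def pd_zero)
    then have r0: "Poly_Mapping.lookup r (a, Suc b) = 0" for a b
      using lookup_pd2[of r a b] by (simp del: of_nat_Suc)
    have keys_r: "snd k = 0" if "k \<in> Poly_Mapping.keys r" for k
      using that r0[of "fst k" "snd k - 1"] by (cases k; cases "snd k") (auto simp: in_keys_iff)
    have "Z = (\<Sum>k\<in>Poly_Mapping.keys r.
        vf_scale (- Poly_Mapping.lookup r k / of_nat (Suc (fst k))) (vf_L (int (fst k)) (- 1)))"
      (is "_ = ?R")
    proof -
      have "fst (vf_scale y (vf_L (int (fst k)) (- 1))) = 0" for y and k :: "nat \<times> nat"
        by (simp add: vf_scale_def vf_L_def)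
      then have 1: "fst ?R = 0"
        by (simp add: fst_sum)
      have "snd (vf_scale (- x / of_nat (Suc (fst k))) (vf_L (int (fst k)) (- 1)))
          = Poly_Mapping.single k x" if "snd k = 0" for x and k :: "nat \<times> nat"
      proof -
        have "x / of_nat (Suc (fst k)) * (1 + of_nat (fst k)) = x"
          using of_nat_neq_0[of "fst k", where ?'a = complex] by (simp add: add.commute)
        moreover have "(fst k, 0) = k" using that by (simp add: prod_eq_iff)
        ultimately show ?thesis
          by (simp add: vf_scale_def vf_L_def tmon_def mult_single single_uminus)
      qed
      then have "snd ?R
          = (\<Sum>k\<in>Poly_Mapping.keys r. Poly_Mapping.single k (Poly_Mapping.lookup r k))"
        unfolding snd_sum by (intro sum.cong refl) (simp add: keys_r del: of_nat_Suc)
      then have 2: "snd ?R = r"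
        by (simp flip: poly2_eq_sum_monomials)
      show ?thesis using 1 2 by (simp add: Z prod_eq_iff)
    qed
    also have "\<dots> \<in> F.span ?S"
      by (intro F.span_sum F.span_scale in_S) simp_all
    finally have "Z \<in> F.span ?S" .
    moreover have "Y1 \<in> F.span ?S"
      unfolding Y1_def by (intro F.span_scale F.span_base) simp
    moreover have "Y2 \<in> F.span ?S"
      unfolding Y2_def by (intro F.span_sum F.span_scale in_S) simp_all
    ultimately have "Z + (Y1 + Y2) \<in> F.span ?S"
      by (intro F.span_add)
    then show "X \<in> F.span ?S"
      by (simp add: Z_def)
  qed
qed

end

theory Submission
  imports Defs "HOL-Computational_Algebra.Fundamental_Theorem_Algebra"
begin

text \<open>
  The Euler field \<open>E = t\<^sub>1 \<partial>\<^sub>1 + t\<^sub>2 \<partial>\<^sub>2\<close> grades the Lie algebra of fields of constant divergence. Degree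
  \<open>-1\<close> is spanned by \<open>\<partial>\<^sub>1, \<partial>\<^sub>2\<close>, degree \<open>0\<close> consists of the linear fields and is a copy of \<open>gl\<^sub>2\<close>, and the
  remaining generators \<open>L\<^sub>\<alpha>\<close> have positive degree.

  Let \<open>M\<close> be simple. The vectors killed by \<open>\<partial>\<^sub>1\<close> and \<open>\<partial>\<^sub>2\<close> form a nonzero finite-dimensional space on which
  \<open>E\<close> acts; let \<open>c\<close> be an eigenvalue of \<open>E\<close> there of minimal real part. Both \<open>\<partial>\<^sub>1\<close> and \<open>\<partial>\<^sub>2\<close>
  lower eigenvalues by one, and some monomial in them takes a given nonzero vector of \<open>M\<close> to a nonzero
  vector of that space; so no \<open>c - j\<close> with \<open>j > 0\<close> is an eigenvalue of \<open>E\<close> on \<open>M\<close>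
  (\<open>lowest_weight_exists\<close>). The eigenspaces for \<open>c, c + 1, \<dots>\<close> span a submodule, hence \<open>M\<close> (\<open>tail_0\<close>).
  Let \<open>V\<close> be the eigenspace of \<open>c\<close>. It is killed by \<open>\<partial>\<^sub>1, \<partial>\<^sub>2\<close>, so it is finite-dimensional, and it is a
  \<open>gl\<^sub>2\<close>-module.

  Let \<open>proj\<close> be the projection of \<open>M\<close> onto \<open>V\<close> along the higher eigenspaces. It commutes with the linear
  fields and kills the image of every field of positive degree. This says that \<open>proj (X m)\<close> depends on \<open>X\<close>
  only through its constant and linear part, in exactly the way in which the constant term of \<open>X f\<close> does for
  \<open>f\<close> in \<open>A\<^sub>2 \<otimes> V\<close> (\<open>proj_action\<close>, \<open>lookup_T_act_zero\<close>). Therefore the Taylor expansion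
  \<open>m \<mapsto> \<Sum>\<^sub>a\<^sub>b t\<^sub>1\<^sup>a t\<^sub>2\<^sup>b / (a! b!) \<otimes> proj (\<partial>\<^sub>1\<^sup>a \<partial>\<^sub>2\<^sup>b m)\<close> is a homomorphism from \<open>M\<close> to \<open>A\<^sub>2 \<otimes> V\<close>
  (\<open>taylor_action\<close>), by induction on the order of the coefficients.

  For a \<open>gl\<^sub>2\<close>-submodule \<open>U\<close> of \<open>V\<close>, the vectors of \<open>M\<close> with all Taylor coefficients in \<open>U\<close> form a
  submodule (\<open>lie_submodule_partials_in\<close>) that meets \<open>V\<close> in \<open>U\<close>. Since \<open>M\<close> is simple, this shows at one
  stroke that \<open>V\<close> is simple and, for \<open>U = {0}\<close>, that the Taylor expansion is injective. It sends \<open>v\<close> in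
  \<open>V\<close> to \<open>1 \<otimes> v\<close>, so its image, being simple, is the submodule generated by \<open>V\<close> (\<open>taylor_image\<close>).
\<close>

section \<open>The spectrum of an endomorphism\<close>

text \<open>
  The endomorphism is linear on the subspace \<open>M\<close> only; nothing is known about \<open>E\<close> outside \<open>M\<close>.
  This is the form in which an element of a Lie algebra acts on a module.
\<close>

locale endomorphism = vector_space sc
  for sc :: "complex \<Rightarrow> 'm::ab_group_add \<Rightarrow> 'm" +
  fixes M :: "'m set" and E :: "'m \<Rightarrow> 'm"
  assumes subspace_M: "subspace M"
    and E_closed: "v \<in> M \<Longrightarrow> E v \<in> M"
    and E_add: "v \<in> M \<Longrightarrow> w \<in> M \<Longrightarrow> E (v + w) = E v + E w"
    and E_scale: "v \<in> M \<Longrightarrow> E (sc a v) = sc a (E v)"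
begin

lemma zero_M: "0 \<in> M"
  and add_M: "v \<in> M \<Longrightarrow> w \<in> M \<Longrightarrow> v + w \<in> M"
  and diff_M: "v \<in> M \<Longrightarrow> w \<in> M \<Longrightarrow> v - w \<in> M"
  and scale_M: "v \<in> M \<Longrightarrow> sc a v \<in> M"
  using subspace_M by (auto simp: subspace_def intro: subspace_diff)

lemma E_zero: "E 0 = 0"
  using E_scale[OF zero_M, of 0] by simp

lemma E_diff: "v \<in> M \<Longrightarrow> w \<in> M \<Longrightarrow> E (v - w) = E v - E w"
  using E_add[of "v - w" w] diff_M[of v w] by (simp add: algebra_simps)

lemma funpow_closed: "v \<in> M \<Longrightarrow> (E ^^ n) v \<in> M"
  by (induction n) (simp_all add: E_closed)

lemma funpow_add: "v \<in> M \<Longrightarrow> w \<in> M \<Longrightarrow> (E ^^ n) (v + w) = (E ^^ n) v + (E ^^ n) w"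
  by (induction n) (simp_all add: E_add funpow_closed)

lemma funpow_scale: "v \<in> M \<Longrightarrow> (E ^^ n) (sc a v) = sc a ((E ^^ n) v)"
  by (induction n) (simp_all add: E_scale funpow_closed)

lemma funpow_zero: "(E ^^ n) 0 = 0"
  by (induction n) (simp_all add: E_zero)

definition eigenspace :: "complex \<Rightarrow> 'm set" where
  "eigenspace \<mu> = {v\<in>M. E v = sc \<mu> v}"

lemma subspace_eigenspace: "subspace (eigenspace \<mu>)"
  by (rule subspaceI)
    (auto simp: eigenspace_def zero_M add_M scale_M E_zero E_add E_scale scale_right_distrib
      scale_left_commute)

lemma subspace_nonzeroE:
  assumes "subspace S" "S \<noteq> {0}"
  obtains v where "v \<in> S" "v \<noteq> 0"
proof -
  have "0 \<in> S" using assms(1) by (rule subspace_0)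
  then have "\<not> S \<subseteq> {0}" using assms(2) by auto
  then show ?thesis using that by auto
qed

text \<open>
  \<open>poly_at p v\<close> is \<open>p(E) v\<close>, evaluated by Horner's scheme so that induction on \<open>p\<close> applies directly.
\<close>

definition poly_at :: "complex poly \<Rightarrow> 'm \<Rightarrow> 'm" where
  "poly_at p v = fold_coeffs (\<lambda>a w. sc a v + E w) p 0"

lemma poly_at_0: "poly_at 0 v = 0"
  by (simp add: poly_at_def)

lemma poly_at_pCons: "poly_at (pCons a p) v = sc a v + E (poly_at p v)"
  by (cases "p = 0 \<and> a = 0") (auto simp: poly_at_def E_zero)

lemma poly_at_closed: "v \<in> M \<Longrightarrow> poly_at p v \<in> M"
  by (induction p) (simp_all add: poly_at_0 poly_at_pCons zero_M add_M scale_M E_closed)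

lemma poly_at_add: "v \<in> M \<Longrightarrow> poly_at (p + q) v = poly_at p v + poly_at q v"
  by (induction p q rule: poly_induct2)
    (simp_all add: poly_at_0 poly_at_pCons E_add poly_at_closed scale_left_distrib)

lemma poly_at_smult: "v \<in> M \<Longrightarrow> poly_at (smult a p) v = sc a (poly_at p v)"
  by (induction p)
    (simp_all add: poly_at_0 poly_at_pCons E_scale poly_at_closed scale_right_distrib)

lemma poly_at_sum: "v \<in> M \<Longrightarrow> poly_at (sum p I) v = (\<Sum>i\<in>I. poly_at (p i) v)"
  by (induction I rule: infinite_finite_induct) (simp_all add: poly_at_0 poly_at_add)

lemma poly_at_monom: "v \<in> M \<Longrightarrow> poly_at (monom a n) v = sc a ((E ^^ n) v)"
  by (induction n)
    (simp_all add: monom_0 monom_Suc poly_at_0 poly_at_pCons E_zero E_scale funpow_closed)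

lemma poly_at_linear_factor:
  assumes "v \<in> M"
  shows "poly_at ([:- r, 1:] * q) v = E (poly_at q v) - sc r (poly_at q v)"
proof -
  have "[:- r, 1:] * q = smult (- r) q + pCons 0 q"
    by simp
  then show ?thesis
    using assms by (simp only: poly_at_add poly_at_smult poly_at_pCons) simp
qed

lemma poly_at_mult: "v \<in> M \<Longrightarrow> poly_at (p * q) v = poly_at p (poly_at q v)"
  by (induction p) (simp_all add: poly_at_0 poly_at_add poly_at_smult poly_at_pCons)

lemma poly_at_eigenvector: "v \<in> eigenspace \<mu> \<Longrightarrow> poly_at p v = sc (poly p \<mu>) v"
  by (induction p)
    (auto simp: poly_at_0 poly_at_pCons eigenspace_def E_scale scale_left_distrib mult.commute)

lemma poly_at_plus:
  "v \<in> M \<Longrightarrow> w \<in> M \<Longrightarrow> poly_at p (v + w) = poly_at p v + poly_at p w"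
  by (induction p)
    (simp_all add: poly_at_0 poly_at_pCons E_add poly_at_closed scale_right_distrib)

lemma poly_at_scale: "v \<in> M \<Longrightarrow> poly_at p (sc a v) = sc a (poly_at p v)"
  by (induction p)
    (simp_all add: poly_at_0 poly_at_pCons E_scale poly_at_closed scale_right_distrib
      scale_left_commute)

lemma poly_at_zero: "poly_at p 0 = 0"
  using poly_at_scale[OF zero_M, of p 0] by simp

lemma subspace_poly_at_kernel: "subspace {v\<in>M. poly_at p v = 0}"
  by (rule subspaceI) (auto simp: poly_at_zero poly_at_plus poly_at_scale zero_M add_M scale_M)

text \<open>
  The vectors \<open>v, E v, E\<^sup>2 v, \<dots>\<close> cannot all be distinct and linearly independent in a space of
  finite dimension; a repetition among them and a linear relation between them both amount to a
  polynomial that annihilates \<open>v\<close>.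
\<close>

lemma annihilating_poly_exists:
  assumes "finite B" "M \<subseteq> span B" "v \<in> M"
  shows "\<exists>p. p \<noteq> 0 \<and> poly_at p v = 0"
proof (cases "inj (\<lambda>i. (E ^^ i) v)")
  case True
  let ?e = "\<lambda>i. (E ^^ i) v"
  have "infinite (range ?e)"
    using True finite_imageD by blast
  moreover have "range ?e \<subseteq> span B"
    using funpow_closed assms by blast
  ultimately have "dependent (range ?e)"
    using independent_span_bound assms(1) by blast
  then obtain T u w where T: "T \<subseteq> range ?e" "finite T" "(\<Sum>x\<in>T. sc (u x) x) = 0"
    and w: "w \<in> T" "u w \<noteq> 0"
    unfolding dependent_explicit by blast
  obtain I where I: "T = ?e ` I"
    using T(1) by (meson subset_imageE)
  have injI: "inj_on ?e I" using True by (meson inj_on_subset subset_UNIV)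
  have finI: "finite I" using T I injI finite_image_iff by blast
  define p where "p = (\<Sum>i\<in>I. monom (u (?e i)) i)"
  have "poly_at p v = (\<Sum>i\<in>I. sc (u (?e i)) (?e i))"
    by (simp add: p_def poly_at_sum poly_at_monom assms(3))
  also have "\<dots> = 0"
    using T(3) I injI by (simp add: sum.reindex)
  finally have "poly_at p v = 0" .
  moreover obtain j where j: "j \<in> I" "w = ?e j"
    using w I by auto
  have "coeff p j = u w"
    using finI j by (simp add: p_def coeff_sum coeff_monom)
  then have "p \<noteq> 0" using w by auto
  ultimately show ?thesis by blast
next
  case False
  then obtain i j where ij: "i \<noteq> j" "(E ^^ i) v = (E ^^ j) v"
    by (auto simp: inj_def)
  define p where "p = monom 1 i + monom (- 1 :: complex) j"
  have "coeff p i = 1"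
    using ij by (simp add: p_def)
  then have "p \<noteq> 0" by auto
  moreover have "poly_at p v = 0"
    by (simp add: p_def poly_at_add poly_at_monom assms(3) ij)
  ultimately show ?thesis by blast
qed

text \<open>
  Over the complex numbers \<open>p = (X - r) q\<close>. Either \<open>q(E) v\<close> is nonzero, and then it is an
  eigenvector of eigenvalue \<open>r\<close>, or \<open>q\<close> is an annihilating polynomial of smaller degree.
\<close>

lemma eigenvector_of_annihilating_poly:
  assumes "p \<noteq> 0" "v \<in> M" "v \<noteq> 0" "poly_at p v = 0"
  shows "\<exists>\<mu>. eigenspace \<mu> \<noteq> {0}"
  using assms
proof (induction "degree p" arbitrary: p)
  case 0
  then obtain a where "p = [:a:]"
    using degree_eq_zeroE by metis
  then show ?case
    using 0 by (simp add: poly_at_pCons poly_at_0 E_zero)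
next
  case (Suc n)
  then have "\<not> constant (poly p)"
    by (simp add: constant_degree)
  then obtain r where "poly p r = 0"
    using fundamental_theorem_of_algebra by blast
  then obtain q where q: "p = [:- r, 1:] * q"
    by (auto simp: poly_eq_0_iff_dvd elim: dvdE)
  then have q0: "q \<noteq> 0" using Suc.prems by auto
  have "degree p = Suc (degree q)"
    unfolding q using q0 by (subst degree_mult_eq) auto
  then have deg: "n = degree q" using Suc.hyps(2) by simp
  show ?case
  proof (cases "poly_at q v = 0")
    case True
    then show ?thesis using Suc.hyps(1)[OF deg q0] Suc.prems by blast
  next
    case False
    have "poly_at q v \<in> eigenspace r"
      using Suc.prems q poly_at_linear_factor[of v r q] poly_at_closed by (simp add: eigenspace_def)
    then show ?thesis using False by blast
  qed
qed

lemma annihilating_poly_finite_dim: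
  assumes "finite B" "span B = M"
  shows "\<exists>p. p \<noteq> 0 \<and> (\<forall>v\<in>M. poly_at p v = 0)"
proof -
  have BM: "B \<subseteq> M" using assms(2) span_superset by blast
  have "\<exists>p. p \<noteq> 0 \<and> (\<forall>v\<in>C. poly_at p v = 0)" if "C \<subseteq> B" for C
    using finite_subset[OF that assms(1)] that
  proof (induction C)
    case empty
    then show ?case by (intro exI[of _ 1]) simp
  next
    case (insert b C)
    have "C \<subseteq> B" "b \<in> M" using insert.prems BM by auto
    then obtain p where p: "p \<noteq> 0" "\<And>v. v \<in> C \<Longrightarrow> poly_at p v = 0"
      using insert.IH by metis
    obtain q where q: "q \<noteq> 0" "poly_at q b = 0"
      using annihilating_poly_exists[OF assms(1) equalityD2[OF assms(2)] \<open>b \<in> M\<close>] by metis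
    have "poly_at (p * q) v = 0" if "v \<in> insert b C" for v
    proof -
      have vM: "v \<in> M" using that BM insert.prems by auto
      have "poly_at (p * q) v = poly_at p (poly_at q v)" "poly_at (p * q) v = poly_at q (poly_at p v)"
        using poly_at_mult[OF vM, of p q] poly_at_mult[OF vM, of q p] by (simp_all only: mult.commute)
      then show ?thesis using that p(2)[of v] q(2) by (auto simp: poly_at_zero)
    qed
    then show ?case using p(1) q(1) by (intro exI[of _ "p * q"]) simp
  qed
  then obtain p where p: "p \<noteq> 0" "\<And>v. v \<in> B \<Longrightarrow> poly_at p v = 0"
    by (meson order_refl)
  have "span B \<subseteq> {v\<in>M. poly_at p v = 0}"
    using p BM by (intro span_minimal subspace_poly_at_kernel) auto
  then have "\<forall>v\<in>M. poly_at p v = 0" unfolding assms(2) by blast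
  then show ?thesis using p(1) by blast
qed

text \<open>
  Every eigenvalue is a root of the polynomial that annihilates the whole space.
\<close>

lemma finite_spectrum:
  assumes "finite B" "span B = M"
  shows "finite {\<mu>. eigenspace \<mu> \<noteq> {0}}"
proof -
  obtain p where p: "p \<noteq> 0" "\<And>v. v \<in> M \<Longrightarrow> poly_at p v = 0"
    using annihilating_poly_finite_dim[OF assms] by blast
  have "poly p \<mu> = 0" if nz: "eigenspace \<mu> \<noteq> {0}" for \<mu>
  proof -
    obtain v where "v \<in> eigenspace \<mu>" "v \<noteq> 0"
      using subspace_nonzeroE[OF subspace_eigenspace nz] .
    then show ?thesis
      using poly_at_eigenvector[of v \<mu> p] p(2)[of v] by (simp add: eigenspace_def)
  qed
  then show ?thesis
    by (intro finite_subset[OF _ poly_roots_finite[OF p(1)]]) auto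
qed

lemma spectrum_nonempty:
  assumes "finite B" "span B = M" "M \<noteq> {0}"
  shows "{\<mu>. eigenspace \<mu> \<noteq> {0}} \<noteq> {}"
proof -
  obtain v where "v \<in> M" "v \<noteq> 0"
    using subspace_nonzeroE[OF subspace_M assms(3)] .
  then show ?thesis
    using annihilating_poly_finite_dim[OF assms(1,2)] eigenvector_of_annihilating_poly
    by (metis (mono_tags) empty_Collect_eq)
qed

end

section \<open>Polynomial vector fields\<close>

abbreviation "lk \<equiv> Poly_Mapping.lookup"

text \<open>
  Polynomials are sums of monomials, so identities that are additive in each argument, such as the
  Leibniz rule, need to be checked for monomials only.
\<close>

lemma poly2_induct [case_names monomial add]:
  fixes p :: poly2
  assumes "\<And>a b c. P (Poly_Mapping.single (a, b) c)" "\<And>p q. P p \<Longrightarrow> P q \<Longrightarrow> P (p + q)"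
  shows "P p"
proof -
  have zero: "P 0"
    using assms(1)[of 0 0 0] by simp
  have "P (\<Sum>k\<in>K. Poly_Mapping.single k (lk p k))" if "finite K" for K
    using that
  proof (induction K)
    case (insert k K)
    then show ?case by (cases k) (auto intro: assms)
  qed (simp add: zero)
  then show ?thesis
    using poly2_eq_sum_monomials[of p] finite_keys[of p] by metis
qed

lemma pd_mult:
  "pd1 (p * q) = pd1 p * q + p * pd1 q" "pd2 (p * q) = pd2 p * q + p * pd2 q"
proof -
  have "pd1 (p * q) = pd1 p * q + p * pd1 q \<and> pd2 (p * q) = pd2 p * q + p * pd2 q"
  proof (induction p rule: poly2_induct)
    case (monomial a b c)
    show ?case
    proof (induction q rule: poly2_induct)
      case (monomial a' b' c')
      show ?case
        by (cases a; cases a'; cases b; cases b')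
          (simp_all add: mult_single pd_monomial ring_distribs add_ac mult_ac flip: single_add)
    next
      case (add q r)
      then show ?case by (simp add: pd_add algebra_simps)
    qed
  next
    case (add p r)
    then show ?case by (simp add: pd_add algebra_simps)
  qed
  then show "pd1 (p * q) = pd1 p * q + p * pd1 q" "pd2 (p * q) = pd2 p * q + p * pd2 q"
    by auto
qed

lemma lookup_mult_zero: "lk (p * q) (0, 0) = lk p (0, 0) * lk (q :: poly2) (0, 0)"
proof (induction p rule: poly2_induct)
  case (monomial a b c)
  show ?case
    by (induction q rule: poly2_induct)
      (auto simp: mult_single lookup_single lookup_add when_def algebra_simps)
qed (simp add: lookup_add algebra_simps)

lemma pd_commute: "pd1 (pd2 p) = pd2 (pd1 p)"
  by (auto intro!: poly_mapping_eqI simp: lookup_pd1 lookup_pd2)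

lemma single_zero_one: "Poly_Mapping.single (0::nat, 0::nat) (1::complex) = 1"
  by (simp flip: zero_prod_def)

lemma pd_one: "pd1 1 = 0" "pd2 1 = 0"
  by (simp_all add: pd_monomial flip: single_zero_one)

text \<open>
  The linear field \<open>\<Sum>\<^sub>i\<^sub>j A\<^sub>i\<^sub>j t\<^sub>i \<partial>\<^sub>j\<close>. The matrix unit \<open>E\<^sub>i\<^sub>j\<close> goes to \<open>t\<^sub>i \<partial>\<^sub>j\<close>, which makes
  \<open>vf_lin\<close> a homomorphism of Lie algebras (\<open>vf_lin_bracket\<close>), and the identity matrix goes to the
  Euler field \<open>t\<^sub>1 \<partial>\<^sub>1 + t\<^sub>2 \<partial>\<^sub>2\<close>.
\<close>

definition vf_lin :: "complex^2^2 \<Rightarrow> vfield" where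
  "vf_lin A =
     (Poly_Mapping.single (1, 0) (A $ 1 $ 1) + Poly_Mapping.single (0, 1) (A $ 2 $ 1),
      Poly_Mapping.single (1, 0) (A $ 1 $ 2) + Poly_Mapping.single (0, 1) (A $ 2 $ 2))"

abbreviation vf_euler :: vfield where "vf_euler \<equiv> vf_lin (mat 1)"

text \<open>
  The matrix \<open>\<partial>\<^sub>i(X\<^sub>j)\<close> at the origin, with the index convention of \<open>vf_lin\<close>: \<open>vf_lin (jac X)\<close> is the
  linear part of \<open>X\<close>.
\<close>

definition jac :: "vfield \<Rightarrow> complex^2^2" where
  "jac X = (\<chi> i j. lk ((if i = 1 then pd1 else pd2) ((if j = 1 then fst else snd) X)) (0, 0))"

lemma jac_nth:
  "jac X $ 1 $ 1 = lk (pd1 (fst X)) (0, 0)" "jac X $ 1 $ 2 = lk (pd1 (snd X)) (0, 0)"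
  "jac X $ 2 $ 1 = lk (pd2 (fst X)) (0, 0)" "jac X $ 2 $ 2 = lk (pd2 (snd X)) (0, 0)"
  by (simp_all add: jac_def)

lemma subspace_S2bar: "module.subspace vf_scale S2bar"
proof -
  interpret vector_space vf_scale by (rule vector_space_vf_scale)
  show ?thesis unfolding S2bar_eq_span by (rule subspace_span)
qed

lemma vf_lin_S2bar: "vf_lin A \<in> S2bar"
  by (auto simp: S2bar_def vf_lin_def pd_add pd_monomial simp flip: single_add zero_prod_def)

lemma vf_d_S2bar: "vf_d1 \<in> S2bar" "vf_d2 \<in> S2bar"
  by (auto simp: S2bar_def vf_d1_def vf_d2_def pd_one pd_zero intro: exI[of _ 0])

lemma vf_bracket_d:
  "vf_bracket vf_d1 X = (pd1 (fst X), pd1 (snd X))"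
  "vf_bracket vf_d2 X = (pd2 (fst X), pd2 (snd X))"
  by (simp_all add: vf_bracket_def vf_app_def vf_d1_def vf_d2_def pd_one pd_zero)

lemma vf_bracket_d_S2bar:
  assumes "X \<in> S2bar"
  shows "vf_bracket vf_d1 X \<in> S2bar" "vf_bracket vf_d2 X \<in> S2bar"
proof -
  obtain c where c: "pd1 (fst X) + pd2 (snd X) = Poly_Mapping.single (0, 0) c"
    using assms by (auto simp: S2bar_def zero_prod_def)
  have "pd1 (pd1 (fst X) + pd2 (snd X)) = 0" "pd2 (pd1 (fst X) + pd2 (snd X)) = 0"
    by (simp_all add: c pd_monomial)
  then show "vf_bracket vf_d1 X \<in> S2bar" "vf_bracket vf_d2 X \<in> S2bar"
    by (auto simp: S2bar_def vf_bracket_d pd_add pd_commute intro!: exI[of _ 0])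
qed

lemma vf_lin_add: "vf_lin (A + B) = vf_lin A + vf_lin B"
  by (simp add: vf_lin_def single_add algebra_simps)

lemma vf_lin_scale: "vf_lin (gl2_scale c A) = vf_scale c (vf_lin A)"
  by (simp add: vf_lin_def vf_scale_def gl2_scale_def distrib_left mult_single zero_prod_def)

lemma vf_lin_bracket: "vf_lin (gl2_bracket A B) = vf_bracket (vf_lin A) (vf_lin B)"
  by (simp add: vf_lin_def vf_bracket_def vf_app_def gl2_bracket_def pd_add pd_monomial
      matrix_matrix_mult_def sum_2 distrib_left distrib_right mult_single single_add single_diff
      algebra_simps)

lemma vf_bracket_euler_lin: "vf_bracket vf_euler (vf_lin A) = 0"
  by (simp add: gl2_bracket_def flip: vf_lin_bracket) (simp add: vf_lin_def zero_prod_def)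

lemma vf_app_euler_monomial:
  "vf_app vf_euler (Poly_Mapping.single (a, b) c) = Poly_Mapping.single (a, b) (of_nat (a + b) * c)"
  by (cases a; cases b)
    (simp_all add: vf_app_def vf_lin_def mat_def pd_monomial mult_single algebra_simps
      flip: single_add)

text \<open>
  \<open>X\<close> maps each coordinate \<open>t\<^sub>i\<close> to its own component \<open>X\<^sub>i\<close>, so bracketing with the Euler field
  multiplies a component of polynomial degree \<open>n\<close> by \<open>n - 1\<close>.
\<close>

lemma vf_bracket_euler:
  "vf_bracket vf_euler X = (vf_app vf_euler (fst X) - fst X, vf_app vf_euler (snd X) - snd X)"
  by (simp add: vf_bracket_def vf_app_def[of X] vf_lin_def mat_def pd_monomial single_zero_one)

lemma vf_L_monomials:
  "vf_L a b = (Poly_Mapping.single (nat (a + 1), nat b) (of_int (1 + b)),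
      - Poly_Mapping.single (nat a, nat (b + 1)) (of_int (1 + a)))"
  by (simp add: vf_L_def tmon_def mult_single del: single_of_int of_int_add)

lemma vf_bracket_euler_L:
  assumes "a \<ge> -1" "b \<ge> -1"
  shows "vf_bracket vf_euler (vf_L a b) = vf_scale (of_int (a + b)) (vf_L a b)"
proof -
  have neg: "vf_app vf_euler (- p) = - vf_app vf_euler p" for p
    by (simp add: vf_app_def pd_uminus)
  have n: "(of_nat (nat (x + 1)) :: complex) = of_int (x + 1)" if "x \<ge> -1" for x
    using that of_nat_nat[of "x + 1"] by simp
  \<comment> \<open>For \<open>x = -1\<close> the exponent is truncated to \<open>0\<close>, but the coefficient \<open>1 + x\<close> vanishes.\<close>
  have n': "of_nat (nat x) * (1 + of_int x :: complex) = of_int x * (1 + of_int x)"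
    if "x \<ge> -1" for x
  proof (cases "x = -1")
    case False
    then have "x \<ge> 0" using that by simp
    then show ?thesis using of_nat_nat[of x] by simp
  qed simp
  show ?thesis
    unfolding vf_bracket_euler vf_L_monomials vf_scale_def fst_conv snd_conv neg
      vf_app_euler_monomial of_nat_add distrib_right n[OF assms(1)] n[OF assms(2)]
    by (simp add: mult_single n' assms flip: single_diff single_uminus single_add)
      (simp add: algebra_simps n' assms)
qed

text \<open>
  The grading by eigenvalues of the Euler field: \<open>\<partial>\<^sub>1, \<partial>\<^sub>2\<close> have degree \<open>-1\<close>, the linear fields
  degree \<open>0\<close>, and the remaining \<open>L\<^sub>\<alpha>\<close> the positive degree \<open>\<alpha>\<^sub>1 + \<alpha>\<^sub>2\<close>.
\<close>

definition vf_homogeneous :: "int \<Rightarrow> vfield \<Rightarrow> bool" where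
  "vf_homogeneous d X \<longleftrightarrow> X \<in> S2bar \<and> vf_bracket vf_euler X = vf_scale (of_int d) X"

lemma vf_t2d2_eq_lin: "vf_t2d2 = vf_lin (gl2_E 2 2)"
  by (simp add: vf_t2d2_def vf_lin_def gl2_E_def tmon_def)

lemma vf_homogeneous_lin: "vf_homogeneous 0 (vf_lin A)"
  by (simp add: vf_homogeneous_def vf_lin_S2bar vf_bracket_euler_lin vf_scale_def zero_prod_def)

lemma vf_homogeneous_L:
  assumes "a \<ge> -1" "b \<ge> -1" "(a, b) \<noteq> (-1, -1)"
  shows "vf_homogeneous (a + b) (vf_L a b)"
proof -
  interpret F: vector_space vf_scale by (rule vector_space_vf_scale)
  have "vf_L a b \<in> S2bar"
    unfolding S2bar_eq_span using assms by (intro F.span_base) blast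
  then show ?thesis
    using assms by (simp add: vf_homogeneous_def vf_bracket_euler_L)
qed

lemma vf_homogeneous_d: "vf_homogeneous (- 1) vf_d1" "vf_homogeneous (- 1) vf_d2"
  unfolding vf_homogeneous_def
  by (simp_all add: vf_d_S2bar vf_bracket_euler)
    (simp_all add: vf_d1_def vf_d2_def vf_app_def pd_one pd_zero vf_scale_def single_uminus)

text \<open>
  By \<open>S2bar_eq_span\<close> a property that is linear in the field needs to be checked only for the
  homogeneous generators; \<open>d\<^sub>2\<close> is among the linear fields.
\<close>

lemma S2bar_induct [consumes 1, case_names lin L add scale]:
  assumes "X \<in> S2bar"
    and lin: "\<And>A. P (vf_lin A)"
    and L: "\<And>a b. a \<ge> -1 \<Longrightarrow> b \<ge> -1 \<Longrightarrow> (a, b) \<noteq> (-1, -1) \<Longrightarrow> P (vf_L a b)"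
    and add: "\<And>X Y. X \<in> S2bar \<Longrightarrow> Y \<in> S2bar \<Longrightarrow> P X \<Longrightarrow> P Y \<Longrightarrow> P (X + Y)"
    and scale: "\<And>c X. X \<in> S2bar \<Longrightarrow> P X \<Longrightarrow> P (vf_scale c X)"
  shows "P X"
proof -
  interpret F: vector_space vf_scale by (rule vector_space_vf_scale)
  note S = subspace_S2bar
  have "P 0"
    using scale[OF vf_lin_S2bar lin, of 0] by simp
  then have "F.subspace {X\<in>S2bar. P X}"
    using add scale F.subspace_0[OF S] F.subspace_add[OF S] F.subspace_scale[OF S]
    by (intro F.subspaceI) auto
  moreover have "insert vf_t2d2 {vf_L a b | a b. a \<ge> -1 \<and> b \<ge> -1 \<and> (a, b) \<noteq> (-1, -1)}
      \<subseteq> {X\<in>S2bar. P X}"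
    using lin L vf_lin_S2bar vf_homogeneous_L
    by (auto simp: vf_t2d2_eq_lin vf_homogeneous_def)
  ultimately have "S2bar \<subseteq> {X\<in>S2bar. P X}"
    by (metis (lifting) F.span_minimal S2bar_eq_span)
  then show ?thesis using assms(1) by auto
qed

lemma jac_add: "jac (X + Y) = jac X + jac Y"
  by (simp add: jac_def vec_eq_iff pd_add lookup_add)

lemma jac_scale: "jac (vf_scale c X) = gl2_scale c (jac X)"
  by (simp add: jac_def vec_eq_iff vf_scale_def gl2_scale_def pd_const_times lookup_const_times)

lemma lookup_vf_scale:
  "lk (fst (vf_scale c X)) k = c * lk (fst X) k" "lk (snd (vf_scale c X)) k = c * lk (snd X) k"
  by (simp_all add: vf_scale_def lookup_const_times)

lemma vf_L_components:
  assumes "a \<ge> -1" "b \<ge> -1"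
  shows "a + b > 0 \<Longrightarrow> jac (vf_L a b) = 0"
    and "a + b > -1 \<Longrightarrow> lk (fst (vf_L a b)) (0, 0) = 0"
    and "a + b > -1 \<Longrightarrow> lk (snd (vf_L a b)) (0, 0) = 0"
proof -
  show "lk (fst (vf_L a b)) (0, 0) = 0" if "a + b > -1"
    using that assms by (auto simp: vf_L_monomials lookup_single when_def)
  show "lk (snd (vf_L a b)) (0, 0) = 0" if "a + b > -1"
    using that assms by (auto simp: vf_L_monomials lookup_single when_def)
  show "jac (vf_L a b) = 0" if "a + b > 0"
    using that assms
    by (auto simp: vec_eq_iff forall_2 jac_nth vf_L_monomials pd_uminus lookup_pd1 lookup_pd2
        lookup_single when_def nat_eq_iff)
qed

lemma vf_L_degree_0:
  assumes "a \<ge> -1" "b \<ge> -1" "a + b = 0"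
  shows "vf_lin (jac (vf_L a b)) = vf_L a b"
proof -
  have "(a, b) \<in> {(-1, 1), (0, 0), (1, -1)}"
    using assms by auto
  then show ?thesis
    by (auto simp: vf_lin_def jac_nth vf_L_monomials pd_uminus lookup_pd1 lookup_pd2
        lookup_single when_def single_uminus)
qed

text \<open>
  In degree \<open>-1\<close> only the exponents \<open>(-1, 0)\<close> and \<open>(0, -1)\<close> occur.
\<close>

lemma vf_L_degree_minus_1:
  assumes "a \<ge> -1" "b \<ge> -1" "a + b = -1"
  shows "vf_L a b = vf_d1 \<or> vf_L a b = vf_scale (- 1) vf_d2"
proof -
  have "(a, b) \<in> {(-1, 0), (0, -1)}"
    using assms by auto
  then show ?thesis
    by (auto simp: vf_L_monomials vf_d1_def vf_d2_def vf_scale_def single_zero_one single_uminus)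
qed

lemma jac_d: "jac vf_d1 = 0" "jac vf_d2 = 0"
  by (simp_all add: vec_eq_iff forall_2 jac_nth vf_d1_def vf_d2_def pd_one pd_zero)

lemma jac_lin: "jac (vf_lin A) = A"
  by (simp add: vec_eq_iff forall_2 jac_nth vf_lin_def lookup_pd1 lookup_pd2 lookup_single
      lookup_add)

section \<open>Derivatives and constant terms in tensor modules\<close>

text \<open>
  An element of \<open>A\<^sub>2 \<otimes> V\<close> is determined by the constant terms of its iterated partial derivatives.
  So the action of a field on it can be tested with two facts: how the action commutes with
  \<open>\<partial>\<^sub>1, \<partial>\<^sub>2\<close> (\<open>T_act_bracket_d\<close>) and what its constant term is (\<open>lookup_T_act_zero\<close>).
\<close>

locale gl2_rep = vector_space sc
  for sc :: "complex \<Rightarrow> 'v::ab_group_add \<Rightarrow> 'v" +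
  fixes V :: "'v set" and \<pi> :: "complex^2^2 \<Rightarrow> 'v \<Rightarrow> 'v"
  assumes gl2: "gl2_module sc V \<pi>"
begin

lemmas vs = vector_space_axioms

lemmas lookup_T = lookup_tens[OF vs] lookup_tensor_scale[OF vs]

lemma subspace_V: "subspace V"
  and \<pi>_add: "v \<in> V \<Longrightarrow> w \<in> V \<Longrightarrow> \<pi> A (v + w) = \<pi> A v + \<pi> A w"
  and \<pi>_scale: "v \<in> V \<Longrightarrow> \<pi> A (sc a v) = sc a (\<pi> A v)"
  and \<pi>_add_matrix: "v \<in> V \<Longrightarrow> \<pi> (A + B) v = \<pi> A v + \<pi> B v"
  and \<pi>_scale_matrix: "v \<in> V \<Longrightarrow> \<pi> (gl2_scale a A) v = sc a (\<pi> A v)"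
  using gl2 unfolding gl2_module_def lie_module_def by blast+

lemma \<pi>_zero: "\<pi> A 0 = 0"
  using \<pi>_scale[OF subspace_0[OF subspace_V], of A 0] by simp

lemma \<pi>_matrix_units:
  assumes "v \<in> V"
  shows "\<pi> A v = sc (A $ 1 $ 1) (\<pi> (gl2_E 1 1) v) + sc (A $ 1 $ 2) (\<pi> (gl2_E 1 2) v)
     + sc (A $ 2 $ 1) (\<pi> (gl2_E 2 1) v) + sc (A $ 2 $ 2) (\<pi> (gl2_E 2 2) v)"
proof -
  have "A = gl2_scale (A $ 1 $ 1) (gl2_E 1 1) + gl2_scale (A $ 1 $ 2) (gl2_E 1 2)
     + gl2_scale (A $ 2 $ 1) (gl2_E 2 1) + gl2_scale (A $ 2 $ 2) (gl2_E 2 2)"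
    by (simp add: vec_eq_iff forall_2 gl2_scale_def gl2_E_def)
  then show ?thesis
    by (metis (no_types) assms \<pi>_add_matrix \<pi>_scale_matrix)
qed

lemma lookup_T_carrier: "f \<in> T_carrier V \<Longrightarrow> lk f k \<in> V"
  unfolding T_carrier_def by blast

lemma zero_T_carrier: "0 \<in> T_carrier V"
  using subspace_0[OF subspace_V] by (simp add: T_carrier_def)

lemma add_T_carrier: "f \<in> T_carrier V \<Longrightarrow> g \<in> T_carrier V \<Longrightarrow> f + g \<in> T_carrier V"
  using subspace_add[OF subspace_V] by (simp add: T_carrier_def lookup_add)

lemma tens_T_carrier: "v \<in> V \<Longrightarrow> tens sc p v \<in> T_carrier V"
  using subspace_scale[OF subspace_V] by (simp add: T_carrier_def lookup_T)

lemma T_pure_zero_right: "T_pure sc \<pi> X p 0 = 0"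
  by (simp add: T_pure_def \<pi>_zero tens_zero_right[OF vs])

lemma T_pure_add_right:
  "v \<in> V \<Longrightarrow> w \<in> V \<Longrightarrow> T_pure sc \<pi> X p (v + w) = T_pure sc \<pi> X p v + T_pure sc \<pi> X p w"
  by (simp add: T_pure_def \<pi>_add tens_add_right[OF vs])

lemma T_act_superset:
  assumes "finite K" "Poly_Mapping.keys f \<subseteq> K"
  shows "T_act sc \<pi> X f = (\<Sum>k\<in>K. T_pure sc \<pi> X (Poly_Mapping.single k 1) (lk f k))"
  unfolding T_act_def
  using assms by (intro sum.mono_neutral_left) (auto simp: in_keys_iff T_pure_zero_right)

lemma T_act_plus:
  assumes "f \<in> T_carrier V" "g \<in> T_carrier V"
  shows "T_act sc \<pi> X (f + g) = T_act sc \<pi> X f + T_act sc \<pi> X g"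
proof -
  let ?K = "Poly_Mapping.keys f \<union> Poly_Mapping.keys g"
  have "Poly_Mapping.keys (f + g) \<subseteq> ?K"
    by (rule keys_add)
  then show ?thesis
    by (simp add: T_act_superset[of ?K] lookup_add T_pure_add_right lookup_T_carrier assms
        flip: sum.distrib)
qed

lemma T_act_zero: "T_act sc \<pi> X 0 = 0"
  by (simp add: T_act_def)

lemma T_act_sum:
  assumes "\<And>i. i \<in> I \<Longrightarrow> f i \<in> T_carrier V"
  shows "T_act sc \<pi> X (sum f I) = (\<Sum>i\<in>I. T_act sc \<pi> X (f i))"
proof -
  have "sum f I \<in> T_carrier V \<and> T_act sc \<pi> X (sum f I) = (\<Sum>i\<in>I. T_act sc \<pi> X (f i))"
    using assms
    by (induction I rule: infinite_finite_induct)
      (simp_all add: T_act_zero zero_T_carrier add_T_carrier T_act_plus)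
  then show ?thesis by blast
qed

lemma T_pure_d:
  "T_pure sc \<pi> vf_d1 p v = tens sc (pd1 p) v" "T_pure sc \<pi> vf_d2 p v = tens sc (pd2 p) v"
  by (simp_all add: T_pure_def vf_app_def vf_d1_def vf_d2_def pd_one pd_zero tens_zero_left[OF vs])

lemma lookup_T_act_d:
  "lk (T_act sc \<pi> vf_d1 f) (a, b) = sc (of_nat (Suc a)) (lk f (Suc a, b))"
  "lk (T_act sc \<pi> vf_d2 f) (a, b) = sc (of_nat (Suc b)) (lk f (a, Suc b))"
proof -
  have collect: "(\<Sum>k\<in>Poly_Mapping.keys f. sc (x * (1 when k = j)) (lk f k)) = sc x (lk f j)" for x j
  proof -
    have "(\<Sum>k\<in>Poly_Mapping.keys f. sc (x * (1 when k = j)) (lk f k))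
        = (\<Sum>k\<in>Poly_Mapping.keys f. if k = j then sc x (lk f k) else 0)"
      by (intro sum.cong) (auto simp: when_def)
    also have "\<dots> = sc x (lk f j)"
      by (simp add: in_keys_iff)
    finally show ?thesis .
  qed
  show "lk (T_act sc \<pi> vf_d1 f) (a, b) = sc (of_nat (Suc a)) (lk f (Suc a, b))"
    unfolding T_act_def T_pure_d lookup_sum lookup_T lookup_pd1 lookup_single by (rule collect)
  show "lk (T_act sc \<pi> vf_d2 f) (a, b) = sc (of_nat (Suc b)) (lk f (a, Suc b))"
    unfolding T_act_def T_pure_d lookup_sum lookup_T lookup_pd2 lookup_single by (rule collect)
qed

lemma T_act_d_plus:
  "T_act sc \<pi> vf_d1 (f + g) = T_act sc \<pi> vf_d1 f + T_act sc \<pi> vf_d1 g"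
  "T_act sc \<pi> vf_d2 (f + g) = T_act sc \<pi> vf_d2 f + T_act sc \<pi> vf_d2 g"
  by (auto intro!: poly_mapping_eqI simp: lookup_T_act_d lookup_add scale_right_distrib)

lemma T_act_d_sum:
  "T_act sc \<pi> vf_d1 (sum f I) = (\<Sum>i\<in>I. T_act sc \<pi> vf_d1 (f i))"
  "T_act sc \<pi> vf_d2 (sum f I) = (\<Sum>i\<in>I. T_act sc \<pi> vf_d2 (f i))"
  by (induction I rule: infinite_finite_induct) (simp_all add: T_act_d_plus T_act_zero)

lemma T_act_d_tens:
  "T_act sc \<pi> vf_d1 (tens sc p v) = tens sc (pd1 p) v"
  "T_act sc \<pi> vf_d2 (tens sc p v) = tens sc (pd2 p) v"
  by (auto intro!: poly_mapping_eqI simp: lookup_T_act_d lookup_T lookup_pd1 lookup_pd2)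

text \<open>
  The Leibniz rule: \<open>\<partial>\<^sub>k\<close> either differentiates the coefficients of the field, which replaces \<open>X\<close>
  by \<open>[\<partial>\<^sub>k, X]\<close>, or the polynomial \<open>p\<close>.
\<close>

lemma T_act_d_pure:
  "T_act sc \<pi> vf_d1 (T_pure sc \<pi> X p v)
     = T_pure sc \<pi> (vf_bracket vf_d1 X) p v + T_pure sc \<pi> X (pd1 p) v"
  "T_act sc \<pi> vf_d2 (T_pure sc \<pi> X p v)
     = T_pure sc \<pi> (vf_bracket vf_d2 X) p v + T_pure sc \<pi> X (pd2 p) v"
  unfolding T_pure_def T_act_d_plus T_act_d_tens vf_bracket_d vf_app_def pd_add pd_mult
  by (simp_all add: pd_commute tens_add_left[OF vs] algebra_simps)

lemma T_act_bracket_d: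
  assumes f: "f \<in> T_carrier V"
  shows "T_act sc \<pi> vf_d1 (T_act sc \<pi> X f)
      = T_act sc \<pi> X (T_act sc \<pi> vf_d1 f) + T_act sc \<pi> (vf_bracket vf_d1 X) f"
    and "T_act sc \<pi> vf_d2 (T_act sc \<pi> X f)
      = T_act sc \<pi> X (T_act sc \<pi> vf_d2 f) + T_act sc \<pi> (vf_bracket vf_d2 X) f"
proof -
  note fV = lookup_T_carrier[OF f]
  have pure: "T_act sc \<pi> X (\<Sum>k\<in>K. tens sc (q k) (lk f k))
      = (\<Sum>k\<in>K. T_pure sc \<pi> X (q k) (lk f k))"
    for q :: "nat \<times> nat \<Rightarrow> poly2" and K
    using T_act_sum[of K "\<lambda>k. tens sc (q k) (lk f k)" X]
    by (simp add: T_act_tens[OF vs gl2] tens_T_carrier fV)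
  show "T_act sc \<pi> vf_d1 (T_act sc \<pi> X f)
      = T_act sc \<pi> X (T_act sc \<pi> vf_d1 f) + T_act sc \<pi> (vf_bracket vf_d1 X) f"
    unfolding T_act_def[of sc \<pi> X f] T_act_d_sum T_act_d_pure sum.distrib
      T_act_def[of sc \<pi> vf_d1 f] T_pure_d pure T_act_def[of sc \<pi> "vf_bracket vf_d1 X" f]
    by (rule add.commute)
  show "T_act sc \<pi> vf_d2 (T_act sc \<pi> X f)
      = T_act sc \<pi> X (T_act sc \<pi> vf_d2 f) + T_act sc \<pi> (vf_bracket vf_d2 X) f"
    unfolding T_act_def[of sc \<pi> X f] T_act_d_sum T_act_d_pure sum.distrib
      T_act_def[of sc \<pi> vf_d2 f] T_pure_d pure T_act_def[of sc \<pi> "vf_bracket vf_d2 X" f]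
    by (rule add.commute)
qed

text \<open>
  The constant term sees only the part of \<open>X\<close> of polynomial degree at most one: its constant part
  picks out the coefficients of \<open>t\<^sub>1\<close> and \<open>t\<^sub>2\<close>, its linear part acts through \<open>gl\<^sub>2\<close>.
\<close>

lemma lookup_T_act_zero:
  assumes f: "f \<in> T_carrier V"
  shows "lk (T_act sc \<pi> X f) (0, 0)
     = sc (lk (fst X) (0, 0)) (lk f (1, 0)) + sc (lk (snd X) (0, 0)) (lk f (0, 1))
       + \<pi> (jac X) (lk f (0, 0))"
proof -
  note fV = lookup_T_carrier[OF f]
  let ?x = "lk (fst X) (0, 0)" and ?y = "lk (snd X) (0, 0)"
  \<comment> \<open>The three relevant exponents are added to the support so that each of the sums below
    collapses to a single coefficient, also where that coefficient is zero.\<close>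
  let ?K = "Poly_Mapping.keys f \<union> {(0, 0), (0, 1), (1, 0)}"
  have "lk (T_pure sc \<pi> X (Poly_Mapping.single k 1) (lk f k)) (0, 0)
     = (if k = (1, 0) then sc ?x (lk f k) else 0) + (if k = (0, 1) then sc ?y (lk f k) else 0)
       + (if k = (0, 0) then \<pi> (jac X) (lk f k) else 0)" for k
    by (cases k)
      (auto simp: T_pure_def vf_app_def lookup_add lookup_T lookup_mult_zero lookup_pd1 lookup_pd2
        lookup_single when_def jac_nth \<pi>_matrix_units[OF fV, of "jac X"])
  note coeff = this
  have "T_act sc \<pi> X f = (\<Sum>k\<in>?K. T_pure sc \<pi> X (Poly_Mapping.single k 1) (lk f k))"
    by (rule T_act_superset) auto
  then show ?thesis
    by (simp only: lookup_sum coeff sum.distrib) simp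
qed

end

section \<open>Modules over the Lie algebra of fields of constant divergence\<close>

locale S2bar_rep = vector_space sc
  for sc :: "complex \<Rightarrow> 'm::ab_group_add \<Rightarrow> 'm" +
  fixes M :: "'m set" and \<rho> :: "vfield \<Rightarrow> 'm \<Rightarrow> 'm"
  assumes lie: "lie_module S2bar vf_scale vf_bracket sc M \<rho>"
begin

lemma endomorphism_action: "X \<in> S2bar \<Longrightarrow> endomorphism sc M (\<rho> X)"
  using lie unfolding lie_module_def by unfold_locales blast+

lemma \<rho>_add: "X \<in> S2bar \<Longrightarrow> Y \<in> S2bar \<Longrightarrow> m \<in> M \<Longrightarrow> \<rho> (X + Y) m = \<rho> X m + \<rho> Y m"
  and \<rho>_scale: "X \<in> S2bar \<Longrightarrow> m \<in> M \<Longrightarrow> \<rho> (vf_scale a X) m = sc a (\<rho> X m)"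
  and \<rho>_bracket: "X \<in> S2bar \<Longrightarrow> Y \<in> S2bar \<Longrightarrow> m \<in> M \<Longrightarrow>
      \<rho> (vf_bracket X Y) m = \<rho> X (\<rho> Y m) - \<rho> Y (\<rho> X m)"
  using lie unfolding lie_module_def by blast+

lemma action_closed: "X \<in> S2bar \<Longrightarrow> m \<in> M \<Longrightarrow> \<rho> X m \<in> M"
  by (rule endomorphism.E_closed[OF endomorphism_action])

lemma action_plus: "X \<in> S2bar \<Longrightarrow> m \<in> M \<Longrightarrow> n \<in> M \<Longrightarrow> \<rho> X (m + n) = \<rho> X m + \<rho> X n"
  by (rule endomorphism.E_add[OF endomorphism_action])

lemma action_minus: "X \<in> S2bar \<Longrightarrow> m \<in> M \<Longrightarrow> n \<in> M \<Longrightarrow> \<rho> X (m - n) = \<rho> X m - \<rho> X n"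
  by (rule endomorphism.E_diff[OF endomorphism_action])

lemma action_sc: "X \<in> S2bar \<Longrightarrow> m \<in> M \<Longrightarrow> \<rho> X (sc a m) = sc a (\<rho> X m)"
  by (rule endomorphism.E_scale[OF endomorphism_action])

lemma action_zero: "X \<in> S2bar \<Longrightarrow> \<rho> X 0 = 0"
  by (rule endomorphism.E_zero[OF endomorphism_action])

lemma \<rho>_zero: "m \<in> M \<Longrightarrow> \<rho> 0 m = 0"
  using \<rho>_scale[OF vf_lin_S2bar, of m 0 0] by (simp add: vf_scale_def zero_prod_def)

abbreviation D1 :: "'m \<Rightarrow> 'm" where "D1 \<equiv> \<rho> vf_d1"
abbreviation D2 :: "'m \<Rightarrow> 'm" where "D2 \<equiv> \<rho> vf_d2"

sublocale euler: endomorphism sc M "\<rho> vf_euler"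
  by (rule endomorphism_action[OF vf_lin_S2bar])
sublocale d1: endomorphism sc M D1
  by (rule endomorphism_action[OF vf_d_S2bar(1)])
sublocale d2: endomorphism sc M D2
  by (rule endomorphism_action[OF vf_d_S2bar(2)])

lemma D_commute: "m \<in> M \<Longrightarrow> D1 (D2 m) = D2 (D1 m)"
  using \<rho>_bracket[OF vf_d_S2bar, of m]
  by (simp add: vf_bracket_d vf_d2_def pd_zero pd_one \<rho>_zero flip: zero_prod_def)

lemma D1_D2_funpow: "m \<in> M \<Longrightarrow> D1 ((D2 ^^ b) m) = (D2 ^^ b) (D1 m)"
  by (induction b) (simp_all add: D_commute d2.funpow_closed)

lemma D1_funpow_D2_funpow: "m \<in> M \<Longrightarrow> (D1 ^^ a) ((D2 ^^ b) m) = (D2 ^^ b) ((D1 ^^ a) m)"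
  by (induction a) (simp_all add: D1_D2_funpow d1.funpow_closed)

lemma D1_action: "X \<in> S2bar \<Longrightarrow> m \<in> M \<Longrightarrow> D1 (\<rho> X m) = \<rho> X (D1 m) + \<rho> (vf_bracket vf_d1 X) m"
  and D2_action: "X \<in> S2bar \<Longrightarrow> m \<in> M \<Longrightarrow> D2 (\<rho> X m) = \<rho> X (D2 m) + \<rho> (vf_bracket vf_d2 X) m"
  by (simp_all add: \<rho>_bracket vf_d_S2bar)

definition partial :: "nat \<Rightarrow> nat \<Rightarrow> 'm \<Rightarrow> 'm" where
  "partial a b m = (D1 ^^ a) ((D2 ^^ b) m)"

lemma partial_closed: "m \<in> M \<Longrightarrow> partial a b m \<in> M"
  by (simp add: partial_def d1.funpow_closed d2.funpow_closed)

lemma partial_add: "m \<in> M \<Longrightarrow> n \<in> M \<Longrightarrow> partial a b (m + n) = partial a b m + partial a b n"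
  by (simp add: partial_def d1.funpow_add d2.funpow_add d2.funpow_closed)

lemma partial_scale: "m \<in> M \<Longrightarrow> partial a b (sc r m) = sc r (partial a b m)"
  by (simp add: partial_def d1.funpow_scale d2.funpow_scale d2.funpow_closed)

lemma partial_zero: "partial a b 0 = 0"
  by (simp add: partial_def d1.funpow_zero d2.funpow_zero)

lemma partial_0_0: "partial 0 0 m = m"
  by (simp add: partial_def)

lemma partial_D1: "m \<in> M \<Longrightarrow> partial a b (D1 m) = partial (Suc a) b m"
  by (simp add: partial_def funpow_swap1 flip: D1_D2_funpow)

lemma partial_D2: "partial a b (D2 m) = partial a (Suc b) m"
  by (simp add: partial_def funpow_swap1)

lemma homogeneous_action:
  assumes "vf_homogeneous d X" "m \<in> euler.eigenspace \<mu>"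
  shows "\<rho> X m \<in> euler.eigenspace (\<mu> + of_int d)"
proof -
  have X: "X \<in> S2bar" "vf_bracket vf_euler X = vf_scale (of_int d) X"
    using assms(1) by (auto simp: vf_homogeneous_def)
  have m: "m \<in> M" "\<rho> vf_euler m = sc \<mu> m"
    using assms(2) by (auto simp: euler.eigenspace_def)
  have "\<rho> vf_euler (\<rho> X m) - \<rho> X (\<rho> vf_euler m) = sc (of_int d) (\<rho> X m)"
    using \<rho>_bracket[OF vf_lin_S2bar X(1) m(1), of "mat 1"] X m by (simp add: \<rho>_scale)
  then have "\<rho> vf_euler (\<rho> X m) = sc (\<mu> + of_int d) (\<rho> X m)"
    using X m by (simp add: action_sc scale_left_distrib algebra_simps)
  then show ?thesis
    using action_closed[OF X(1) m(1)] by (simp add: euler.eigenspace_def)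
qed

text \<open>
  Apply \<open>\<partial>\<^sub>1\<close> as long as the result is nonzero, then \<open>\<partial>\<^sub>2\<close>. Since the two commute, the second stage
  preserves the kernel of \<open>\<partial>\<^sub>1\<close>.
\<close>

lemma Wh0_nonzeroE:
  assumes m: "m \<in> M" "m \<noteq> 0"
    and nil: "\<exists>k. (D1 ^^ k) m = 0" "\<And>m. m \<in> M \<Longrightarrow> \<exists>k. (D2 ^^ k) m = 0"
  obtains a b where "(D2 ^^ b) ((D1 ^^ a) m) \<noteq> 0" "(D2 ^^ b) ((D1 ^^ a) m) \<in> Wh0 M \<rho>"
proof -
  have last: "\<exists>k. (f ^^ k) v \<noteq> 0 \<and> f ((f ^^ k) v) = 0"
    if v: "v \<noteq> 0" and z: "\<exists>k. (f ^^ k) v = 0" for f :: "'m \<Rightarrow> 'm" and v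
  proof -
    define n where "n = (LEAST k. (f ^^ k) v = 0)"
    have n: "(f ^^ n) v = 0"
      unfolding n_def using z by (rule LeastI_ex)
    obtain k where k: "n = Suc k"
      using n v by (cases n) auto
    then have "(f ^^ k) v \<noteq> 0"
      using not_less_Least[of k "\<lambda>k. (f ^^ k) v = 0"] by (simp add: n_def)
    then show ?thesis using n k by auto
  qed
  obtain a where a: "(D1 ^^ a) m \<noteq> 0" "D1 ((D1 ^^ a) m) = 0"
    using last[OF m(2) nil(1)] by blast
  define n where "n = (D1 ^^ a) m"
  have n: "n \<in> M" "n \<noteq> 0" "D1 n = 0"
    using a m by (simp_all add: n_def d1.funpow_closed)
  obtain b where b: "(D2 ^^ b) n \<noteq> 0" "D2 ((D2 ^^ b) n) = 0"
    using last[OF n(2) nil(2)[OF n(1)]] by blast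
  have "(D2 ^^ b) n \<in> Wh0 M \<rho>"
    using n b by (simp add: Wh0_def d2.funpow_closed D1_D2_funpow d2.funpow_zero)
  then show thesis using that b(1) by (simp add: n_def)
qed

end

section \<open>The grading of a simple module and the projection to lowest degree\<close>

text \<open>
  A simple module in which \<open>c\<close> is an eigenvalue of the Euler field but none of \<open>c - 1, c - 2, \<dots>\<close>
  is. It turns out to be the sum of the eigenspaces for \<open>c, c + 1, c + 2, \<dots>\<close>.
\<close>

locale lowest_weight_rep = S2bar_rep sc M \<rho>
  for sc :: "complex \<Rightarrow> 'm::ab_group_add \<Rightarrow> 'm" and M \<rho> +
  fixes c :: complex
  assumes simple: "simple_lie_module S2bar sc M \<rho>"
    and lowest: "euler.eigenspace (c - of_nat (Suc j)) = {0}"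
    and lowest_nonzero: "euler.eigenspace c \<noteq> {0}"
    and D1_nilpotent: "m \<in> M \<Longrightarrow> \<exists>k. (D1 ^^ k) m = 0"
    and D2_nilpotent: "m \<in> M \<Longrightarrow> \<exists>k. (D2 ^^ k) m = 0"
begin

definition V :: "'m set" where "V = euler.eigenspace c"

text \<open>
  The part of degree at least \<open>j\<close>, as a span, so that linear claims about it can be checked on
  eigenvectors.
\<close>

definition tail :: "nat \<Rightarrow> 'm set" where
  "tail j = span (\<Union>k. euler.eigenspace (c + of_nat (j + k)))"

lemma subspace_V: "subspace V"
  unfolding V_def by (rule euler.subspace_eigenspace)

lemma V_sub_M: "v \<in> V \<Longrightarrow> v \<in> M"
  by (simp add: V_def euler.eigenspace_def)

lemma subspace_tail: "subspace (tail j)"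
  unfolding tail_def by (rule subspace_span)

lemma tail_sub_M: "m \<in> tail j \<Longrightarrow> m \<in> M"
proof -
  have "tail j \<subseteq> M"
    unfolding tail_def
    by (rule span_minimal[OF _ euler.subspace_M]) (auto simp: euler.eigenspace_def)
  then show "m \<in> tail j \<Longrightarrow> m \<in> M" by blast
qed

lemma eigenspace_sub_tail: "i \<ge> j \<Longrightarrow> m \<in> euler.eigenspace (c + of_nat i) \<Longrightarrow> m \<in> tail j"
  unfolding tail_def by (rule span_base, rule UN_I[where a = "i - j"]) simp_all

text \<open>
  A field of degree \<open>d\<close> shifts eigenvalues by \<open>d\<close>. The case \<open>j = 0\<close> has no condition on \<open>d\<close>, because
  eigenspaces below \<open>c\<close> are zero.
\<close>

lemma tail_step:
  assumes X: "vf_homogeneous d X" and m: "m \<in> tail i" and j: "j = 0 \<or> int j \<le> int i + d"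
  shows "\<rho> X m \<in> tail j"
proof -
  have XS: "X \<in> S2bar" using X by (simp add: vf_homogeneous_def)
  let ?S = "{m\<in>M. \<rho> X m \<in> tail j}"
  have "tail i \<subseteq> ?S"
    unfolding tail_def[of i]
  proof (rule span_minimal)
    show "subspace ?S"
      using subspace_0[OF subspace_tail] subspace_add[OF subspace_tail]
        subspace_scale[OF subspace_tail]
      by (intro subspaceI)
        (auto simp: euler.zero_M euler.add_M euler.scale_M action_zero action_plus action_sc XS)
    show "(\<Union>k. euler.eigenspace (c + of_nat (i + k))) \<subseteq> ?S"
    proof
      fix m assume "m \<in> (\<Union>k. euler.eigenspace (c + of_nat (i + k)))"
      then obtain k where k: "m \<in> euler.eigenspace (c + of_nat (i + k))" by blast
      then have Xm: "\<rho> X m \<in> euler.eigenspace (c + of_nat (i + k) + of_int d)"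
        by (rule homogeneous_action[OF X])
      have "\<rho> X m \<in> tail j"
      proof (cases "int (i + k) + d \<ge> 0")
        case True
        then obtain n where n: "int (i + k) + d = int n"
          using nonneg_int_cases by blast
        have "c + of_nat (i + k) + of_int d = c + of_int (int (i + k) + d)"
          by simp
        then have "c + of_nat (i + k) + of_int d = c + of_nat n"
          unfolding n by simp
        moreover have "j \<le> n" using j n by linarith
        ultimately show ?thesis using eigenspace_sub_tail Xm by metis
      next
        case False
        then have "int (i + k) + d = - int (Suc (nat (- (int (i + k) + d) - 1)))"
          by simp
        then obtain n where n: "int (i + k) + d = - int (Suc n)" by blast
        have "c + of_nat (i + k) + of_int d = c + of_int (int (i + k) + d)"
          by simp
        then have "c + of_nat (i + k) + of_int d = c - of_nat (Suc n)"
          unfolding n by simp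
        then show ?thesis using Xm lowest[of n] subspace_0[OF subspace_tail] by (metis singletonD)
      qed
      then show "m \<in> ?S" using k by (simp add: euler.eigenspace_def)
    qed
  qed
  then show ?thesis using m by blast
qed

text \<open>
  The generators of the Lie algebra are homogeneous, so the sum of the eigenspaces is a submodule; it
  contains the eigenspace of \<open>c\<close>, and \<open>M\<close> is simple.
\<close>

lemma tail_0: "tail 0 = M"
proof -
  have "\<rho> X m \<in> tail 0" if m: "m \<in> tail 0" and "X \<in> S2bar" for X m
    using that(2)
  proof (induction X rule: S2bar_induct)
    case (lin A)
    show ?case by (rule tail_step[OF vf_homogeneous_lin m]) simp
  next
    case (L a b)
    show ?case by (rule tail_step[OF vf_homogeneous_L[OF L] m]) simp
  next
    case (add X Y)
    then show ?case
      using \<rho>_add tail_sub_M[OF m] subspace_add[OF subspace_tail] by simp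
  next
    case (scale a X)
    then show ?case
      using \<rho>_scale tail_sub_M[OF m] subspace_scale[OF subspace_tail] by simp
  qed
  then have "lie_submodule S2bar sc M \<rho> (tail 0)"
    using subspace_tail tail_sub_M by (auto simp: lie_submodule_def)
  then have "tail 0 = {0} \<or> tail 0 = M"
    using simple by (simp add: simple_lie_module_def)
  moreover have "tail 0 \<noteq> {0}"
  proof -
    obtain v where "v \<in> euler.eigenspace c" "v \<noteq> 0"
      using euler.subspace_nonzeroE[OF euler.subspace_eigenspace lowest_nonzero] .
    then show ?thesis using eigenspace_sub_tail[of 0 0 v] by auto
  qed
  ultimately show ?thesis by blast
qed

lemma V_tail_decomposition:
  assumes "m \<in> M"
  shows "\<exists>v\<in>V. m - v \<in> tail 1"
proof -
  let ?S = "{m. \<exists>v\<in>V. m - v \<in> tail 1}"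
  have "tail 0 \<subseteq> ?S"
    unfolding tail_def[of 0]
  proof (rule span_minimal)
    show "subspace ?S"
    proof (rule subspaceI)
      show "0 \<in> ?S"
        using subspace_0[OF subspace_V] subspace_0[OF subspace_tail, of 1] by force
      fix x y assume "x \<in> ?S" "y \<in> ?S"
      then obtain v w where "v \<in> V" "w \<in> V" "x - v \<in> tail 1" "y - w \<in> tail 1" by blast
      then have "v + w \<in> V" "(x - v) + (y - w) \<in> tail 1"
        by (auto intro: subspace_add subspace_V subspace_tail)
      then show "x + y \<in> ?S"
        by (auto simp: algebra_simps intro!: bexI[of _ "v + w"])
    next
      fix a x assume "x \<in> ?S"
      then obtain v where "v \<in> V" "x - v \<in> tail 1" by blast
      then have "sc a v \<in> V" "sc a (x - v) \<in> tail 1"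
        by (auto intro: subspace_scale subspace_V subspace_tail)
      then show "sc a x \<in> ?S"
        by (auto simp: scale_right_diff_distrib)
    qed
    show "(\<Union>k. euler.eigenspace (c + of_nat (0 + k))) \<subseteq> ?S"
    proof
      fix m assume "m \<in> (\<Union>k. euler.eigenspace (c + of_nat (0 + k)))"
      then obtain k where k: "m \<in> euler.eigenspace (c + of_nat k)" by auto
      show "m \<in> ?S"
      proof (cases k)
        case 0
        then show ?thesis
          using k subspace_0[OF subspace_tail, of 1] by (auto simp: V_def intro!: bexI[of _ m])
      next
        case (Suc n)
        then show ?thesis
          using eigenspace_sub_tail[of 1 k m] k subspace_0[OF subspace_V] by force
      qed
    qed
  qed
  then show ?thesis using assms tail_0 by blast
qed

text \<open>
  Vectors of positive degree are annihilated by \<open>p(E)\<close> for a polynomial \<open>p\<close> that does not vanish at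
  \<open>c\<close>, namely a product of factors \<open>X - (c + k)\<close>. On \<open>V\<close> the operator \<open>p(E)\<close> is multiplication by
  the nonzero scalar \<open>p(c)\<close>.
\<close>

lemma V_inter_tail:
  assumes "v \<in> V" "v \<in> tail 1"
  shows "v = 0"
proof -
  let ?S = "{m\<in>M. \<exists>p. poly p c \<noteq> 0 \<and> euler.poly_at p m = 0}"
  have "tail 1 \<subseteq> ?S"
    unfolding tail_def
  proof (rule span_minimal)
    show "subspace ?S"
    proof (rule subspaceI)
      show "0 \<in> ?S"
        using euler.zero_M euler.poly_at_zero by (auto intro!: exI[of _ 1])
      fix x y assume "x \<in> ?S" "y \<in> ?S"
      then obtain p q where p: "x \<in> M" "poly p c \<noteq> 0" "euler.poly_at p x = 0"
        and q: "y \<in> M" "poly q c \<noteq> 0" "euler.poly_at q y = 0" by blast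
      have "euler.poly_at (q * p) x = 0"
        by (simp add: euler.poly_at_mult p euler.poly_at_zero)
      moreover have "euler.poly_at (p * q) y = 0"
        by (simp add: euler.poly_at_mult q euler.poly_at_zero)
      ultimately have "euler.poly_at (p * q) (x + y) = 0"
        by (simp add: euler.poly_at_plus p(1) q(1) mult.commute)
      then show "x + y \<in> ?S"
        using p q by (auto simp: euler.add_M intro!: exI[of _ "p * q"])
    next
      fix a x assume "x \<in> ?S"
      then show "sc a x \<in> ?S"
        by (auto simp: euler.poly_at_scale euler.scale_M)
    qed
    show "(\<Union>k. euler.eigenspace (c + of_nat (1 + k))) \<subseteq> ?S"
    proof
      fix m assume "m \<in> (\<Union>k. euler.eigenspace (c + of_nat (1 + k)))"
      then obtain k where k: "m \<in> euler.eigenspace (c + of_nat (1 + k))" by blast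
      let ?p = "[:- (c + of_nat (1 + k)), 1:]"
      have "euler.poly_at ?p m = 0"
        by (simp only: euler.poly_at_eigenvector[OF k]) simp
      moreover have "poly ?p c = - of_nat (Suc k)"
        by simp
      then have "poly ?p c \<noteq> 0"
        using of_nat_neq_0[of k, where ?'a = complex] by (simp only: neg_equal_0_iff_equal not_False_eq_True)
      ultimately show "m \<in> ?S"
        using k unfolding euler.eigenspace_def by blast
    qed
  qed
  then obtain p where "poly p c \<noteq> 0" "euler.poly_at p v = 0"
    using assms(2) by blast
  then show ?thesis
    using euler.poly_at_eigenvector[of v c p] assms(1) by (simp add: V_def)
qed

definition proj :: "'m \<Rightarrow> 'm" where
  "proj m = (THE v. v \<in> V \<and> m - v \<in> tail 1)"

lemma proj_eqI:
  assumes "v \<in> V" "m - v \<in> tail 1"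
  shows "proj m = v"
  unfolding proj_def
proof (rule the_equality)
  fix w assume w: "w \<in> V \<and> m - w \<in> tail 1"
  have "(m - v) - (m - w) \<in> tail 1"
    using subspace_diff[OF subspace_tail] assms w by blast
  moreover have "w - v \<in> V"
    using subspace_diff[OF subspace_V] assms w by blast
  ultimately show "w = v"
    using V_inter_tail[of "w - v"] by simp
qed (use assms in blast)

lemma proj_V: "m \<in> M \<Longrightarrow> proj m \<in> V"
  and proj_tail: "m \<in> M \<Longrightarrow> m - proj m \<in> tail 1"
  using V_tail_decomposition proj_eqI by metis+

lemma proj_M: "m \<in> M \<Longrightarrow> proj m \<in> M"
  using proj_V V_sub_M by blast

lemma proj_id: "v \<in> V \<Longrightarrow> proj v = v"
  using subspace_0[OF subspace_tail] by (intro proj_eqI) simp_all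

lemma proj_zero: "proj 0 = 0"
  by (rule proj_id[OF subspace_0[OF subspace_V]])

lemma proj_plus: "m \<in> M \<Longrightarrow> n \<in> M \<Longrightarrow> proj (m + n) = proj m + proj n"
proof (rule proj_eqI)
  assume mn: "m \<in> M" "n \<in> M"
  show "proj m + proj n \<in> V"
    using mn by (intro subspace_add[OF subspace_V] proj_V)
  have "(m - proj m) + (n - proj n) \<in> tail 1"
    using mn by (intro subspace_add[OF subspace_tail] proj_tail)
  then show "m + n - (proj m + proj n) \<in> tail 1"
    by (simp add: algebra_simps)
qed

lemma proj_scale: "m \<in> M \<Longrightarrow> proj (sc a m) = sc a (proj m)"
proof (rule proj_eqI)
  assume m: "m \<in> M"
  show "sc a (proj m) \<in> V"
    using m by (intro subspace_scale[OF subspace_V] proj_V)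
  have "sc a (m - proj m) \<in> tail 1"
    using m by (intro subspace_scale[OF subspace_tail] proj_tail)
  then show "sc a m - sc a (proj m) \<in> tail 1"
    by (simp add: scale_right_diff_distrib)
qed

lemma V_degree_0: "vf_homogeneous 0 X \<Longrightarrow> v \<in> V \<Longrightarrow> \<rho> X v \<in> V"
  using homogeneous_action[of 0 X v c] by (simp add: V_def)

lemma proj_degree_0:
  assumes X: "vf_homogeneous 0 X" and m: "m \<in> M"
  shows "proj (\<rho> X m) = \<rho> X (proj m)"
proof (rule proj_eqI)
  show "\<rho> X (proj m) \<in> V"
    using V_degree_0[OF X proj_V[OF m]] .
  have "\<rho> X (m - proj m) \<in> tail 1"
    using tail_step[OF X proj_tail[OF m]] by simp
  then show "\<rho> X m - \<rho> X (proj m) \<in> tail 1"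
    using X m by (simp add: action_minus proj_M vf_homogeneous_def)
qed

lemma proj_degree_positive:
  assumes X: "vf_homogeneous d X" "d > 0" and m: "m \<in> M"
  shows "proj (\<rho> X m) = 0"
proof (rule proj_eqI)
  show "0 \<in> V" by (rule subspace_0[OF subspace_V])
  show "\<rho> X m - 0 \<in> tail 1"
    using tail_step[OF X(1), of m 0 1] X(2) m tail_0 by simp
qed

text \<open>
  The counterpart of \<open>lookup_T_act_zero\<close> for the module \<open>M\<close>: a field of positive degree maps \<open>M\<close>
  into the kernel of \<open>proj\<close>, a linear one commutes with \<open>proj\<close>, and those of degree \<open>-1\<close> are combinations
  of \<open>\<partial>\<^sub>1\<close> and \<open>\<partial>\<^sub>2\<close>.
\<close>

lemma proj_action:
  assumes "X \<in> S2bar" and m: "m \<in> M"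
  shows "proj (\<rho> X m) = sc (lk (fst X) (0, 0)) (proj (D1 m)) + sc (lk (snd X) (0, 0)) (proj (D2 m))
     + \<rho> (vf_lin (jac X)) (proj m)"
  using assms(1)
proof (induction X rule: S2bar_induct)
  case (lin A)
  show ?case
    using proj_degree_0[OF vf_homogeneous_lin m, of A]
    by (simp add: jac_lin) (simp add: vf_lin_def lookup_add lookup_single)
next
  case (L a b)
  have lin0: "\<rho> (vf_lin 0) (proj m) = 0"
    using \<rho>_zero[OF proj_M[OF m]] by (simp add: vf_lin_def flip: zero_prod_def)
  consider "a + b = -1" | "a + b = 0" | "a + b > 0"
    using L by force
  then show ?case
  proof cases
    case 1
    have "vf_L a b = vf_d1 \<or> vf_L a b = vf_scale (- 1) vf_d2"
      using L 1 by (intro vf_L_degree_minus_1)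
    moreover have "gl2_scale (- 1) 0 = 0"
      by (simp add: gl2_scale_def vec_eq_iff)
    ultimately show ?thesis
    proof (elim disjE)
      assume "vf_L a b = vf_d1"
      then show ?thesis
        by (simp add: jac_d lin0) (simp add: vf_d1_def flip: single_zero_one)
    next
      assume L: "vf_L a b = vf_scale (- 1) vf_d2"
      have "proj (\<rho> (vf_L a b) m) = - proj (D2 m)"
        using proj_scale[of "D2 m" "- 1"] m by (simp add: L \<rho>_scale vf_d_S2bar action_closed)
      then show ?thesis
        using \<open>gl2_scale (- 1) 0 = 0\<close>
        by (simp add: L jac_scale jac_d lin0)
          (simp add: vf_d2_def vf_scale_def mult_single flip: single_zero_one)
    qed
  next
    case 2
    then show ?thesis
      using L proj_degree_0[OF _ m, of "vf_L a b"] vf_homogeneous_L[OF L]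
      by (simp add: vf_L_components vf_L_degree_0)
  next
    case 3
    then show ?thesis
      using L proj_degree_positive[OF vf_homogeneous_L[OF L] _ m]
      by (simp add: vf_L_components lin0)
  qed
next
  case (add X Y)
  then show ?case
    using m proj_M[OF m]
    by (simp add: \<rho>_add proj_plus action_closed jac_add vf_lin_add vf_lin_S2bar lookup_add
        scale_left_distrib)
next
  case (scale a X)
  then show ?case
    using m proj_M[OF m]
    by (simp add: \<rho>_scale proj_scale action_closed jac_scale vf_lin_scale vf_lin_S2bar
        lookup_vf_scale scale_right_distrib)
qed

section \<open>Simplicity of the lowest eigenspace\<close>

lemma V_nonzero: "V \<noteq> {0}"
  unfolding V_def by (rule lowest_nonzero)

lemma V_sub_Wh0: "V \<subseteq> Wh0 M \<rho>"
proof
  fix v assume v: "v \<in> V"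
  have "c + of_int (- 1) = c - of_nat (Suc 0)"
    by simp
  then have "D1 v = 0" "D2 v = 0"
    using homogeneous_action[OF vf_homogeneous_d(1), of v c]
      homogeneous_action[OF vf_homogeneous_d(2), of v c] v lowest[of 0]
    unfolding V_def by (metis singletonD)+
  then show "v \<in> Wh0 M \<rho>"
    using V_sub_M[OF v] by (simp add: Wh0_def)
qed

lemma partial_V: "v \<in> V \<Longrightarrow> partial a b v = (if a = 0 \<and> b = 0 then v else 0)"
  using V_sub_Wh0 V_sub_M
  by (cases a; cases b)
    (auto simp: partial_0_0 partial_zero Wh0_def subset_iff simp flip: partial_D1 partial_D2)

definition gl2_act :: "complex^2^2 \<Rightarrow> 'm \<Rightarrow> 'm" where
  "gl2_act A = \<rho> (vf_lin A)"

lemma gl2_module_V: "gl2_module sc V gl2_act"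
  unfolding gl2_module_def lie_module_def gl2_act_def
  using subspace_V V_degree_0[OF vf_homogeneous_lin] V_sub_M vector_space_axioms
  by (simp add: action_plus action_sc \<rho>_add \<rho>_scale \<rho>_bracket vf_lin_S2bar vf_lin_add
      vf_lin_scale vf_lin_bracket)

text \<open>
  The vectors all of whose Taylor coefficients lie in \<open>U\<close>. For a \<open>gl\<^sub>2\<close>-submodule \<open>U\<close> of \<open>V\<close> this
  is a submodule of \<open>M\<close> that meets \<open>V\<close> in \<open>U\<close>. As \<open>M\<close> is simple, it is \<open>{0}\<close> or \<open>M\<close>, and so \<open>U\<close> is
  \<open>{0}\<close> or \<open>V\<close>; for \<open>U = {0}\<close> it is the kernel of the Taylor expansion.
\<close>

definition partials_in :: "'m set \<Rightarrow> 'm set" where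
  "partials_in U = {m\<in>M. \<forall>a b. proj (partial a b m) \<in> U}"

text \<open>
  Induction on the number of derivatives: \<open>\<partial>\<^sub>k X m = X \<partial>\<^sub>k m + [\<partial>\<^sub>k, X] m\<close>, where \<open>\<partial>\<^sub>k m\<close> is again of
  the required kind and \<open>[\<partial>\<^sub>k, X]\<close> is another field; without derivatives the claim is
  \<open>proj_action\<close>. The induction therefore runs over all fields and all vectors at once.
\<close>

lemma proj_partial_action:
  assumes U: "lie_submodule UNIV sc V gl2_act U"
    and "X \<in> S2bar" "m \<in> partials_in U"
  shows "proj (partial a b (\<rho> X m)) \<in> U"
proof -
  have sub: "subspace U" and act: "\<And>A u. u \<in> U \<Longrightarrow> \<rho> (vf_lin A) u \<in> U"
    using U by (auto simp: lie_submodule_def gl2_act_def)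
  have D: "D1 n \<in> partials_in U" "D2 n \<in> partials_in U" if "n \<in> partials_in U" for n
    using that
    by (auto simp: partials_in_def partial_D1 partial_D2 action_closed vf_d_S2bar)
  have M: "n \<in> M" if "n \<in> partials_in U" for n
    using that by (simp add: partials_in_def)
  have zero: "proj (\<rho> X n) \<in> U" if X: "X \<in> S2bar" and n: "n \<in> partials_in U" for X n
  proof -
    have "proj n \<in> U" "proj (D1 n) \<in> U" "proj (D2 n) \<in> U"
      using n D[OF n] partial_0_0 unfolding partials_in_def by (metis (lifting) mem_Collect_eq)+
    then show ?thesis
      unfolding proj_action[OF X M[OF n]]
      by (intro subspace_add[OF sub] subspace_scale[OF sub] act)
  qed
  have D1s: "proj (partial a 0 (\<rho> X n)) \<in> U" if "X \<in> S2bar" "n \<in> partials_in U" for X n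
    using that
  proof (induction a arbitrary: X n)
    case (Suc a)
    have "partial (Suc a) 0 (\<rho> X n) = partial a 0 (\<rho> X (D1 n)) + partial a 0 (\<rho> (vf_bracket vf_d1 X) n)"
      using Suc.prems M[OF Suc.prems(2)]
      by (simp add: D1_action partial_add action_closed vf_d_S2bar vf_bracket_d_S2bar flip: partial_D1)
    then show ?case
      using Suc M[OF Suc.prems(2)] D
      by (simp add: proj_plus partial_closed action_closed vf_d_S2bar vf_bracket_d_S2bar
          subspace_add[OF sub])
  qed (simp add: partial_0_0 zero)
  show ?thesis
    using assms(2,3)
  proof (induction b arbitrary: X m)
    case (Suc b)
    have "partial a (Suc b) (\<rho> X m) = partial a b (\<rho> X (D2 m)) + partial a b (\<rho> (vf_bracket vf_d2 X) m)"
      using Suc.prems M[OF Suc.prems(2)]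
      by (simp add: D2_action partial_add action_closed vf_d_S2bar vf_bracket_d_S2bar flip: partial_D2)
    then show ?case
      using Suc M[OF Suc.prems(2)] D
      by (simp add: proj_plus partial_closed action_closed vf_d_S2bar vf_bracket_d_S2bar
          subspace_add[OF sub])
  qed (rule D1s)
qed

lemma lie_submodule_partials_in:
  assumes U: "lie_submodule UNIV sc V gl2_act U"
  shows "lie_submodule S2bar sc M \<rho> (partials_in U)"
proof -
  have sub: "subspace U" using U by (simp add: lie_submodule_def)
  have "subspace (partials_in U)"
    using subspace_0[OF sub] subspace_add[OF sub] subspace_scale[OF sub]
    by (intro subspaceI)
      (auto simp: partials_in_def euler.zero_M euler.add_M euler.scale_M partial_zero partial_add
        partial_scale proj_zero proj_plus proj_scale partial_closed)
  then show ?thesis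
    using proj_partial_action[OF U]
    by (auto simp: lie_submodule_def) (auto simp: partials_in_def action_closed)
qed

lemma partials_in_cases:
  assumes "lie_submodule UNIV sc V gl2_act U"
  shows "partials_in U = {0} \<or> partials_in U = M"
  using simple lie_submodule_partials_in[OF assms] by (simp add: simple_lie_module_def)

lemma partials_in_V_iff:
  assumes "lie_submodule UNIV sc V gl2_act U" "v \<in> V"
  shows "v \<in> partials_in U \<longleftrightarrow> v \<in> U"
proof -
  have "0 \<in> U"
    using assms(1) subspace_0 by (simp add: lie_submodule_def)
  then show ?thesis
    using assms(2)
    by (auto simp: partials_in_def partial_V V_sub_M proj_id proj_zero split: if_splits)
qed

lemma simple_V: "simple_lie_module UNIV sc V gl2_act"
  unfolding simple_lie_module_def
proof (intro conjI allI impI)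
  show "V \<noteq> {0}" by (rule V_nonzero)
  fix U assume U: "lie_submodule UNIV sc V gl2_act U"
  then have UV: "U \<subseteq> V" and sub: "subspace U" by (simp_all add: lie_submodule_def)
  from partials_in_cases[OF U] show "U = {0} \<or> U = V"
  proof
    assume "partials_in U = {0}"
    then have "U \<subseteq> {0}" using partials_in_V_iff[OF U] UV by blast
    then show ?thesis using subspace_0[OF sub] by auto
  next
    assume "partials_in U = M"
    then have "V \<subseteq> U" using partials_in_V_iff[OF U] V_sub_M by blast
    then show ?thesis using UV by auto
  qed
qed

lemma partials_in_0: "partials_in {0} = {0}"
proof -
  have U: "lie_submodule UNIV sc V gl2_act {0}"
    using subspace_0[OF subspace_V] by (auto simp: lie_submodule_def gl2_act_def action_zero vf_lin_S2bar)
  obtain v where v: "v \<in> V" "v \<noteq> 0"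
    using euler.subspace_nonzeroE[OF subspace_V V_nonzero] .
  then have "v \<notin> partials_in {0}" using partials_in_V_iff[OF U] by simp
  then show ?thesis using partials_in_cases[OF U] V_sub_M[OF v(1)] by auto
qed

section \<open>The Taylor embedding into the tensor module\<close>

sublocale T: gl2_rep sc V gl2_act
  by unfold_locales (rule gl2_module_V)

text \<open>
  The candidate for the isomorphism. It is the only map that commutes with \<open>\<partial>\<^sub>1, \<partial>\<^sub>2\<close> and has
  constant term \<open>proj m\<close>, whence the factorials.
\<close>

definition taylor :: "'m \<Rightarrow> (nat \<times> nat) \<Rightarrow>\<^sub>0 'm" where
  "taylor m = Abs_poly_mapping (\<lambda>(a, b). sc (1 / (fact a * fact b)) (proj (partial a b m)))"

text \<open>
  Only finitely many coefficients are nonzero, because \<open>\<partial>\<^sub>1\<close> and \<open>\<partial>\<^sub>2\<close> act nilpotently on \<open>m\<close> and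
  commute.
\<close>

lemma lookup_taylor:
  assumes m: "m \<in> M"
  shows "lk (taylor m) (a, b) = sc (1 / (fact a * fact b)) (proj (partial a b m))"
proof -
  obtain k l where k: "(D1 ^^ k) m = 0" and l: "(D2 ^^ l) m = 0"
    using D1_nilpotent[OF m] D2_nilpotent[OF m] by blast
  have beyond: "(f ^^ n) m = 0" if le: "j \<le> n" and j: "(f ^^ j) m = 0" and f: "f 0 = 0"
    for f :: "'m \<Rightarrow> 'm" and n j :: nat
    using le
  proof (induction n rule: dec_induct)
    case (step n)
    then show ?case using f by simp
  qed (fact j)
  have van: "partial a b m = 0" if "a \<ge> k \<or> b \<ge> l" for a b
    using that
  proof
    assume "a \<ge> k"
    then have "(D1 ^^ a) m = 0" using beyond k d1.E_zero by blast
    then show ?thesis unfolding partial_def D1_funpow_D2_funpow[OF m] by (simp add: d2.funpow_zero)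
  next
    assume "b \<ge> l"
    then have "(D2 ^^ b) m = 0" using beyond l d2.E_zero by blast
    then show ?thesis unfolding partial_def by (simp add: d1.funpow_zero)
  qed
  have "{x. (case x of (a, b) \<Rightarrow> sc (1 / (fact a * fact b)) (proj (partial a b m))) \<noteq> 0}
      \<subseteq> {..<k} \<times> {..<l}"
    using van proj_zero by (auto simp: not_le[symmetric])
  then have "finite {x. (case x of (a, b) \<Rightarrow> sc (1 / (fact a * fact b)) (proj (partial a b m))) \<noteq> 0}"
    by (rule finite_subset) simp
  then show ?thesis
    unfolding taylor_def by (simp add: lookup_Abs_poly_mapping)
qed

lemma taylor_plus: "m \<in> M \<Longrightarrow> n \<in> M \<Longrightarrow> taylor (m + n) = taylor m + taylor n"
  by (auto intro!: poly_mapping_eqI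
      simp: lookup_taylor lookup_add partial_add proj_plus partial_closed euler.add_M scale_right_distrib)

lemma taylor_scale: "m \<in> M \<Longrightarrow> taylor (sc a m) = tensor_scale sc a (taylor m)"
  by (auto intro!: poly_mapping_eqI
      simp: lookup_taylor T.lookup_T partial_scale proj_scale partial_closed euler.scale_M mult.commute)

lemma taylor_T_carrier: "m \<in> M \<Longrightarrow> taylor m \<in> T_carrier V"
  by (auto simp: T_carrier_def lookup_taylor intro!: subspace_scale[OF subspace_V] proj_V partial_closed)

lemma taylor_V: "v \<in> V \<Longrightarrow> taylor v = tens sc 1 v"
  by (auto intro!: poly_mapping_eqI
      simp: lookup_taylor V_sub_M partial_V proj_id proj_zero T.lookup_T lookup_single when_def
      simp flip: single_zero_one)

lemma taylor_D:
  assumes "m \<in> M"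
  shows "taylor (D1 m) = T_act sc gl2_act vf_d1 (taylor m)"
    and "taylor (D2 m) = T_act sc gl2_act vf_d2 (taylor m)"
  using assms
  by (auto intro!: poly_mapping_eqI
      simp: lookup_taylor T.lookup_T_act_d action_closed vf_d_S2bar partial_D1 partial_D2 field_simps
      simp del: of_nat_Suc)

text \<open>
  Both sides have the same constant term by \<open>proj_action\<close> and \<open>lookup_T_act_zero\<close>. A coefficient of
  higher order is, up to a nonzero integer factor, a coefficient of lower order of the derivative;
  both sides commute with derivatives in the same way, by \<open>D1_action\<close> and \<open>T_act_bracket_d\<close>, which
  leaves the claim for the pairs \<open>X, \<partial>\<^sub>k m\<close> and \<open>[\<partial>\<^sub>k, X], m\<close>.
\<close>

lemma lookup_taylor_action:
  assumes "X \<in> S2bar" "m \<in> M"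
  shows "lk (taylor (\<rho> X m)) (a, b) = lk (T_act sc gl2_act X (taylor m)) (a, b)"
proof -
  have cancel: "u = v" if "sc (of_nat (Suc n)) u = sc (of_nat (Suc n)) v" for u v and n :: nat
    using that scale_left_imp_eq[of "of_nat (Suc n)" u v] of_nat_neq_0[of n] by blast
  have zero: "lk (taylor (\<rho> X m)) (0, 0) = lk (T_act sc gl2_act X (taylor m)) (0, 0)"
    if "X \<in> S2bar" "m \<in> M" for X m
    using that
    by (simp add: lookup_taylor T.lookup_T_act_zero taylor_T_carrier action_closed partial_0_0
        proj_action gl2_act_def) (simp add: partial_def)
  have D1s: "lk (taylor (\<rho> X m)) (a, 0) = lk (T_act sc gl2_act X (taylor m)) (a, 0)"
    if "X \<in> S2bar" "m \<in> M" for X m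
    using that
  proof (induction a arbitrary: X m)
    case (Suc a)
    have XM: "\<rho> X m \<in> M" "D1 m \<in> M" "\<rho> X (D1 m) \<in> M" "\<rho> (vf_bracket vf_d1 X) m \<in> M"
      using Suc.prems by (simp_all add: action_closed vf_d_S2bar vf_bracket_d_S2bar)
    have "lk (T_act sc gl2_act vf_d1 (taylor (\<rho> X m))) (a, 0)
        = lk (T_act sc gl2_act vf_d1 (T_act sc gl2_act X (taylor m))) (a, 0)"
      using Suc.IH[of X "D1 m"] Suc.IH[of "vf_bracket vf_d1 X" m] Suc.prems XM
      by (simp add: T.T_act_bracket_d taylor_T_carrier D1_action taylor_plus lookup_add
          vf_bracket_d_S2bar flip: taylor_D)
    then show ?case
      unfolding T.lookup_T_act_d by (rule cancel)
  qed (rule zero)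
  show ?thesis
    using assms
  proof (induction b arbitrary: X m)
    case (Suc b)
    have XM: "\<rho> X m \<in> M" "D2 m \<in> M" "\<rho> X (D2 m) \<in> M" "\<rho> (vf_bracket vf_d2 X) m \<in> M"
      using Suc.prems by (simp_all add: action_closed vf_d_S2bar vf_bracket_d_S2bar)
    have "lk (T_act sc gl2_act vf_d2 (taylor (\<rho> X m))) (a, b)
        = lk (T_act sc gl2_act vf_d2 (T_act sc gl2_act X (taylor m))) (a, b)"
      using Suc.IH[of X "D2 m"] Suc.IH[of "vf_bracket vf_d2 X" m] Suc.prems XM
      by (simp add: T.T_act_bracket_d taylor_T_carrier D2_action taylor_plus lookup_add
          vf_bracket_d_S2bar flip: taylor_D)
    then show ?case
      unfolding T.lookup_T_act_d by (rule cancel)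
  qed (rule D1s)
qed

lemma taylor_action:
  "X \<in> S2bar \<Longrightarrow> m \<in> M \<Longrightarrow> taylor (\<rho> X m) = T_act sc gl2_act X (taylor m)"
  by (auto intro!: poly_mapping_eqI simp: lookup_taylor_action)

lemma taylor_eq_0: "m \<in> M \<Longrightarrow> taylor m = 0 \<Longrightarrow> m = 0"
proof -
  assume m: "m \<in> M" "taylor m = 0"
  have "proj (partial a b m) = 0" for a b
    using lookup_taylor[OF m(1), of a b] m(2) by simp
  then show "m = 0"
    using partials_in_0 m(1) by (auto simp: partials_in_def)
qed

lemma taylor_zero: "taylor 0 = 0"
  using taylor_V[OF subspace_0[OF subspace_V]] by (simp add: tens_zero_right[OF vector_space_axioms])

lemma inj_on_taylor: "inj_on taylor M"
proof (rule inj_onI)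
  fix m n assume mn: "m \<in> M" "n \<in> M" "taylor m = taylor n"
  have "taylor m = taylor (m - n) + taylor n"
    using taylor_plus[of "m - n" n] mn by (simp add: euler.diff_M)
  then have "taylor (m - n) = 0" using mn(3) by simp
  then have "m - n = 0" using taylor_eq_0 mn euler.diff_M by blast
  then show "m = n" by simp
qed

text \<open>
  The preimage of \<open>U\<close> is a submodule of \<open>M\<close>. This is how the simplicity of \<open>M\<close> transfers to the
  tensor module.
\<close>

lemma taylor_pullback:
  assumes sub: "module.subspace (tensor_scale sc) U"
    and act: "\<And>X f. X \<in> S2bar \<Longrightarrow> f \<in> U \<Longrightarrow> T_act sc gl2_act X f \<in> U"
  shows "U \<inter> taylor ` M = {0} \<or> taylor ` M \<subseteq> U"
proof -
  interpret TS: vector_space "tensor_scale sc"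
    by (rule vector_space_tensor_scale[OF vector_space_axioms])
  let ?N = "{m\<in>M. taylor m \<in> U}"
  have "subspace ?N"
    using TS.subspace_0[OF sub] TS.subspace_add[OF sub] TS.subspace_scale[OF sub]
    by (intro subspaceI)
      (auto simp: taylor_zero taylor_plus taylor_scale euler.zero_M euler.add_M euler.scale_M)
  then have "lie_submodule S2bar sc M \<rho> ?N"
    using act by (auto simp: lie_submodule_def action_closed taylor_action)
  then have "?N = {0} \<or> ?N = M"
    using simple by (simp add: simple_lie_module_def)
  then show ?thesis
  proof
    assume N: "?N = {0}"
    have "U \<inter> taylor ` M \<subseteq> taylor ` ?N" by blast
    also have "\<dots> = {0}" unfolding N by (simp add: taylor_zero)
    finally show ?thesis
      using TS.subspace_0[OF sub] euler.zero_M taylor_zero by (auto simp: image_iff)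
  next
    assume "?N = M"
    then show ?thesis by blast
  qed
qed

lemma lie_submodule_taylor_image:
  "lie_submodule S2bar (tensor_scale sc) (T_carrier V) (T_act sc gl2_act) (taylor ` M)"
proof -
  interpret TS: vector_space "tensor_scale sc"
    by (rule vector_space_tensor_scale[OF vector_space_axioms])
  have "TS.subspace (taylor ` M)"
  proof (rule TS.subspaceI)
    show "0 \<in> taylor ` M"
      using euler.zero_M taylor_zero by (metis imageI)
    show "x + y \<in> taylor ` M" if "x \<in> taylor ` M" "y \<in> taylor ` M" for x y
      using that euler.add_M by (auto simp flip: taylor_plus)
    show "tensor_scale sc a x \<in> taylor ` M" if "x \<in> taylor ` M" for a x
      using that euler.scale_M by (auto simp flip: taylor_scale)
  qed
  then show ?thesis
    using taylor_T_carrier action_closed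
    by (auto simp: lie_submodule_def simp flip: taylor_action)
qed

text \<open>
  The image is a submodule containing \<open>1 \<otimes> V\<close>, and a submodule that contains \<open>1 \<otimes> V\<close> meets the
  image nontrivially, hence contains all of it.
\<close>

lemma taylor_image: "taylor ` M = T1 sc V gl2_act"
proof
  have V: "tens sc 1 ` V \<subseteq> taylor ` M"
    using taylor_V V_sub_M by (auto simp: image_iff) metis
  then show "T1 sc V gl2_act \<subseteq> taylor ` M"
    unfolding T1_def generated_submodule_def using lie_submodule_taylor_image by blast
  have "taylor ` M \<subseteq> U"
    if U: "lie_submodule S2bar (tensor_scale sc) (T_carrier V) (T_act sc gl2_act) U"
      and VU: "tens sc 1 ` V \<subseteq> U" for U
  proof -
    obtain v where v: "v \<in> V" "v \<noteq> 0"
      using euler.subspace_nonzeroE[OF subspace_V V_nonzero] .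
    then have "taylor v \<in> taylor ` M" "taylor v \<noteq> 0"
      using V_sub_M taylor_eq_0 by blast+
    moreover have "taylor v \<in> U"
      using taylor_V[OF v(1)] VU v(1) by auto
    ultimately show ?thesis
      using taylor_pullback[of U] U by (auto simp: lie_submodule_def)
  qed
  then show "taylor ` M \<subseteq> T1 sc V gl2_act"
    unfolding T1_def generated_submodule_def by blast
qed

lemma simple_T1:
  "simple_lie_module S2bar (tensor_scale sc) (T1 sc V gl2_act) (T_act sc gl2_act)"
  unfolding simple_lie_module_def taylor_image[symmetric]
proof (intro conjI allI impI)
  obtain v where v: "v \<in> V" "v \<noteq> 0"
    using euler.subspace_nonzeroE[OF subspace_V V_nonzero] .
  then show "taylor ` M \<noteq> {0}"
    using taylor_eq_0 V_sub_M by blast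
  fix U assume "lie_submodule S2bar (tensor_scale sc) (taylor ` M) (T_act sc gl2_act) U"
  then show "U = {0} \<or> U = taylor ` M"
    using taylor_pullback[of U] by (auto simp: lie_submodule_def)
qed

lemma iso_T1:
  "lie_module_iso S2bar sc M \<rho> (tensor_scale sc) (T1 sc V gl2_act) (T_act sc gl2_act)"
  unfolding lie_module_iso_def taylor_image[symmetric]
  using inj_on_taylor taylor_plus taylor_scale taylor_action
  by (intro exI[of _ taylor]) (auto simp: bij_betw_def)

lemma finite_dim_V:
  assumes "finite_dim sc (Wh0 M \<rho>)"
  shows "finite_dim sc V"
proof -
  obtain B where B: "finite B" "span B = Wh0 M \<rho>"
    using assms by (auto simp: finite_dim_def)
  obtain C where C: "C \<subseteq> V" "independent C" "V \<subseteq> span C"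
    using basis_exists[of V] .
  have "C \<subseteq> span B"
    unfolding B(2) by (rule order_trans[OF C(1) V_sub_Wh0])
  then have "finite C"
    using independent_span_bound[OF B(1) C(2)] by blast
  moreover have "span C = V"
    using C(3) span_minimal[OF C(1) subspace_V] by (rule equalityI[rotated])
  ultimately show ?thesis
    unfolding finite_dim_def by blast
qed

end

section \<open>Existence of a lowest eigenvalue\<close>

context S2bar_rep
begin

text \<open>
  The Euler field acts on the nonzero finite-dimensional space \<open>Wh\<^sub>0\<close>, where it has finitely many
  eigenvalues and at least one. One of minimal real part is lowest on all of \<open>M\<close>: an eigenvector for
  \<open>c - j\<close> with \<open>j > 0\<close> could be moved by \<open>\<partial>\<^sub>1\<close> and \<open>\<partial>\<^sub>2\<close> into \<open>Wh\<^sub>0\<close>, which lowers its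
  eigenvalue further.
\<close>

lemma lowest_weight_exists:
  assumes simple: "simple_lie_module S2bar sc M \<rho>"
    and nil1: "\<And>m. m \<in> M \<Longrightarrow> \<exists>k. (D1 ^^ k) m = 0"
    and nil2: "\<And>m. m \<in> M \<Longrightarrow> \<exists>k. (D2 ^^ k) m = 0"
    and fin: "finite_dim sc (Wh0 M \<rho>)"
  shows "\<exists>c. lowest_weight_rep sc M \<rho> c"
proof -
  let ?W = "Wh0 M \<rho>"
  have E_W: "\<rho> vf_euler w \<in> ?W" if w: "w \<in> ?W" for w
  proof -
    have br: "vf_bracket vf_d1 vf_euler = vf_d1" "vf_bracket vf_d2 vf_euler = vf_d2"
      unfolding vf_bracket_d
      by (simp_all add: vf_lin_def mat_def pd_add pd_monomial vf_d1_def vf_d2_def single_zero_one)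
    show ?thesis
      using w D1_action[OF vf_lin_S2bar, of w "mat 1"] D2_action[OF vf_lin_S2bar, of w "mat 1"]
      by (simp add: Wh0_def br euler.E_closed euler.E_zero)
  qed
  interpret W: endomorphism sc ?W "\<rho> vf_euler"
  proof
    show "subspace ?W"
      by (rule subspaceI)
        (auto simp: Wh0_def euler.zero_M euler.add_M euler.scale_M d1.E_zero d2.E_zero d1.E_add
          d2.E_add d1.E_scale d2.E_scale)
  qed (auto simp: E_W, auto simp: Wh0_def euler.E_add euler.E_scale)
  have W_eigen: "W.eigenspace \<mu> = ?W \<inter> euler.eigenspace \<mu>" for \<mu>
    unfolding W.eigenspace_def euler.eigenspace_def by (auto simp: Wh0_def)
  obtain B where B: "finite B" "span B = ?W"
    using fin by (auto simp: finite_dim_def)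
  have "M \<noteq> {0}" using simple by (simp add: simple_lie_module_def)
  then obtain m where m: "m \<in> M" "m \<noteq> 0"
    using euler.subspace_nonzeroE[OF euler.subspace_M] by metis
  then have "?W \<noteq> {0}"
    using Wh0_nonzeroE[OF m nil1[OF m(1)] nil2] by blast
  let ?\<Lambda> = "{\<mu>. W.eigenspace \<mu> \<noteq> {0}}"
  have "finite ?\<Lambda>" "?\<Lambda> \<noteq> {}"
    using W.finite_spectrum[OF B] W.spectrum_nonempty[OF B \<open>?W \<noteq> {0}\<close>] by simp_all
  then obtain c where "is_arg_min Re (\<lambda>\<mu>. \<mu> \<in> ?\<Lambda>) c"
    using ex_is_arg_min_if_finite by blast
  then have c: "c \<in> ?\<Lambda>" and min: "\<And>\<mu>. \<mu> \<in> ?\<Lambda> \<Longrightarrow> \<not> Re \<mu> < Re c"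
    by (auto simp: is_arg_min_def)
  have "lowest_weight_rep sc M \<rho> c"
  proof
    show "simple_lie_module S2bar sc M \<rho>" by (fact simple)
    obtain w where "w \<in> W.eigenspace c" "w \<noteq> 0"
      using W.subspace_nonzeroE[OF W.subspace_eigenspace] c by blast
    then show "euler.eigenspace c \<noteq> {0}"
      unfolding W_eigen by blast
    fix j
    show "euler.eigenspace (c - of_nat (Suc j)) = {0}"
    proof (rule ccontr)
      assume "euler.eigenspace (c - of_nat (Suc j)) \<noteq> {0}"
      then obtain m where m: "m \<in> euler.eigenspace (c - of_nat (Suc j))" "m \<noteq> 0"
        using euler.subspace_nonzeroE[OF euler.subspace_eigenspace] by metis
      then have mM: "m \<in> M" by (simp add: euler.eigenspace_def)
      obtain a b where ab: "(D2 ^^ b) ((D1 ^^ a) m) \<noteq> 0" "(D2 ^^ b) ((D1 ^^ a) m) \<in> ?W"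
        using Wh0_nonzeroE[OF mM m(2) nil1[OF mM] nil2] .
      have lower: "(\<rho> X ^^ n) v \<in> euler.eigenspace (\<mu> - of_nat n)"
        if "v \<in> euler.eigenspace \<mu>" "vf_homogeneous (- 1) X" for X v \<mu> and n :: nat
      proof (induction n)
        case (Suc n)
        then show ?case
          using homogeneous_action[OF that(2) Suc] by (simp add: algebra_simps)
      qed (simp add: that)
      have "(D2 ^^ b) ((D1 ^^ a) m)
          \<in> euler.eigenspace (c - of_nat (Suc j) - of_nat a - of_nat b)"
        by (intro lower m vf_homogeneous_d)
      then have "c - of_nat (Suc j) - of_nat a - of_nat b \<in> ?\<Lambda>"
        using ab unfolding W_eigen by blast
      then show False
        using min by fastforce
    qed
  qed (use nil1 nil2 in blast)+
  then show ?thesis ..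
qed

end

theorem proposition4p1:
  fixes sc :: "complex \<Rightarrow> 'm::ab_group_add \<Rightarrow> 'm"
    and M :: "'m set"
    and \<rho> :: "vfield \<Rightarrow> 'm \<Rightarrow> 'm"
  assumes "Omega0 sc M \<rho>"
    and "simple_lie_module S2bar sc M \<rho>"
  shows "\<exists>(V :: 'm set) \<pi>.
           gl2_module sc V \<pi> \<and> finite_dim sc V \<and> simple_lie_module UNIV sc V \<pi> \<and>
           simple_lie_module S2bar (tensor_scale sc) (T1 sc V \<pi>) (T_act sc \<pi>) \<and>
           lie_module_iso S2bar sc M \<rho> (tensor_scale sc) (T1 sc V \<pi>) (T_act sc \<pi>)"
proof -
  have lie: "lie_module S2bar vf_scale vf_bracket sc M \<rho>"
    and nil: "\<And>v x. v \<in> M \<Longrightarrow> x \<in> Delta2 \<Longrightarrow> \<exists>k. (\<rho> x ^^ k) v = 0"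
    and fin: "finite_dim sc (Wh0 M \<rho>)"
    using assms(1) by (auto simp: Omega0_def)
  interpret vector_space sc
    using lie by (simp add: lie_module_def)
  interpret S2bar_rep sc M \<rho>
    by unfold_locales (rule lie)
  interpret F: vector_space vf_scale by (rule vector_space_vf_scale)
  have "vf_d1 \<in> Delta2" "vf_d2 \<in> Delta2"
    by (simp_all add: Delta2_def F.span_base)
  then obtain c where "lowest_weight_rep sc M \<rho> c"
    using lowest_weight_exists[OF assms(2) _ _ fin] nil by blast
  then interpret lowest_weight_rep sc M \<rho> c .
  show ?thesis
    using gl2_module_V finite_dim_V[OF fin] simple_V simple_T1 iso_T1 by blast
qed

end
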